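(* Let $\mathcal V=(\mathcal V,\le,\otimes,\mathrm k)$ be a (unital, commutative) quantale satisfying (A) $\mathrm k=\bigvee\{\varepsilon\in\mathcal V\mid\varepsilon\lll\mathrm k\}$ or (B) $\mathrm k\wedge(-):\mathcal V\to\mathcal V$ preserves arbitrary joins. For each small $\mathcal V$-normed category $\mathbb X$, the category $\Phi(\mathbb X)$ is (essentially) small.
   Context: A quantale $(\mathcal V,\le,\otimes,\mathrm k)$ is a complete lattice with a commutative monoid structure $(\mathcal V,\otimes,\mathrm k)$ such that each $-\otimes v$ preserves arbitrary joins; $[v,-]$ denotes the right adjoint of $-\otimes v$. For $u,v\in\mathcal V$, $u\lll v$ means: whenever $v\le\bigvee W$ with $W\subseteq\mathcal V$, then $u\le w$ for some $w\in W$. A $\mathcal V$-normed set is a set $A$ with a function $|\cdot|:A\to\mathcal V$. $\mathsf{Set}/\!/\mathcal V$ is the category of $\mathcal V$-normed sets and maps $f$ with $|a|\le|fa|$. $\mathsf{Set}||\mathcal V$ has the same objects, and arbitrary maps $\varphi:A\to B$ as morphisms, with norm $|\varphi|=\bigwedge_{a\in A}[|a|,|\varphi a|]$. A $\mathcal V$-normed category is a category $\mathbb X$ with a value $|f|\in\mathcal V$ for every morphism $f$ such that $\mathrm k\le|1_x|$ and $|f|\otimes|g|\le|g\cdot f|$. A functor $F$ is $\mathcal V$-normed if $|f|\le|Ff|$ for all $f$. The dual category keeps the norms. For a small $\mathcal V$-normed category $\mathbb A$, $\mathcal P\mathbb A=[\mathbb A^{\mathrm{op}},\mathsf{Set}||\mathcal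 V]$ has as objects the $\mathcal V$-normed functors and as morphisms all natural transformations, normed by $|\alpha|=\bigwedge_x|\alpha_x|$; its hom-objects are denoted $\mathrm{Nat}(-,-)$. The representables are the presheaves $\mathbb A(-,a)$. A sequence $s=(s_{m,n}:x_m\to x_n)_{m\le n}$ (a functor from the ordered set $\mathbb N$) is Cauchy if $\mathrm k\le\bigvee_N\bigwedge_{n\ge m\ge N}|s_{m,n}|$. A normed colimit of $s$ is an object $x$ with an (ordinary) colimit cocone $\gamma$ such that $|f|=\bigvee_N\bigwedge_{n\ge N}|f\cdot\gamma_n|$ for every morphism $f$ with domain $x$. For $\mathcal V$-normed functors $F:\mathbb A\to\mathbb Y$ and $\phi:\mathbb A^{\mathrm{op}}\to\mathsf{Set}||\mathcal V$, a $\phi$-weighted colimit of $F$ is an object $x$ of $\mathbb Y$ with isomorphisms $\mathbb Y(x,y)\cong\mathrm{Nat}(\phi,\mathbb Y(F-,y))$ in $\mathsf{Set}/\!/\mathcal V$, natural in $y$. For each small $\mathcal V$-normed category $\mathbb A$, $\Phi[\mathbb A]$ is the class of those $\phi\in\mathcal P\mathbb A$ which are normed colimits of Cauchy sequences of representables in $\mathcal P\mathbb A$, and $\Phi=\sum_{\mathbb A\text{ small}}\Phi[\mathbb A]$. $\Phi(\mathbb X)$ is the smallest replete (i.e. closed under isomorphism in the category of $\mathrm k$-morphisms, where $\mathrm k\le|f|$) full $\mathcal V$-normed subcategory of $\mathcal P\mathbb X$ that contains $\mathbb X$ (via the Yoneda embedding) and is closed under $\Phi$-colimits, i.e. contains with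 the values of any $F:\mathbb A\to\mathcal P\mathbb X$ ($\mathbb A$ small) also the $\phi$-weighted colimits of $F$ in $\mathcal P\mathbb X$ for all $\phi\in\Phi[\mathbb A]$. As $\Phi(\mathbb X)$ is replete, "small" is understood up to equivalence. *)

theory Defs
  imports Main "HOL-Library.FuncSet"
begin

section \<open>Smallness\<close>

text \<open>
  Size is measured against a Grothendieck universe, given as a type \<open>'u\<close>: a set (of any type) is
  small if its cardinality is strictly below that of \<open>'u\<close>.  Up to bijection the small sets are
  then exactly the small subsets of \<open>'u\<close>.  The conditions of \<open>grothendieck_universe\<close>
  (infinity, power set, union/replacement) say that the cardinality of \<open>'u\<close> is strongly
  inaccessible.
\<close>

definition small :: "'u itself \<Rightarrow> 'e set \<Rightarrow> bool" where
  "small _ A \<longleftrightarrow> (card_of A, card_of (UNIV :: 'u set)) \<in> ordLess"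

definition grothendieck_universe :: "'u itself \<Rightarrow> bool" where
  "grothendieck_universe U \<longleftrightarrow>
     (\<exists>N :: 'u set. infinite N \<and> small U N) \<and>
     (\<forall>A :: 'u set. small U A \<longrightarrow> small U (Pow A)) \<and>
     (\<forall>(I :: 'u set) (A :: 'u \<Rightarrow> 'u set).
        small U I \<longrightarrow> (\<forall>i\<in>I. small U (A i)) \<longrightarrow> small U (\<Union>i\<in>I. A i))"


section \<open>Quantales\<close>

text \<open>The tensor product is written \<open>*\<close> and its unit \<open>k\<close> is \<open>1\<close>.\<close>

class comm_quantale = complete_lattice + comm_monoid_mult +
  assumes Sup_mult_distrib: "Sup W * v = (SUP w\<in>W. w * v)"

definition qhom :: "'v::comm_quantale \<Rightarrow> 'v \<Rightarrow> 'v" where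
  "qhom v w = Sup {u. u * v \<le> w}"

lemma qhom_adjoint: "u * v \<le> w \<longleftrightarrow> u \<le> qhom v w" for u v w :: "'v::comm_quantale"
proof
  assume "u * v \<le> w"
  then show "u \<le> qhom v w" by (simp add: qhom_def Sup_upper)
next
  assume "u \<le> qhom v w"
  have mono: "a * v \<le> b * v" if "a \<le> b" for a b :: 'v
  proof -
    have "Sup {a, b} * v = (SUP x\<in>{a, b}. x * v)" by (rule Sup_mult_distrib)
    moreover from that have "Sup {a, b} = b" by (simp add: sup.absorb2)
    ultimately show ?thesis by (simp add: le_iff_sup)
  qed
  from \<open>u \<le> qhom v w\<close> have "u * v \<le> Sup {u. u * v \<le> w} * v"
    unfolding qhom_def by (rule mono)
  also have "\<dots> \<le> w"
    unfolding Sup_mult_distrib by (auto intro: SUP_least)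
  finally show "u * v \<le> w" .
qed

definition totally_below :: "'v::complete_lattice \<Rightarrow> 'v \<Rightarrow> bool" where
  "totally_below u v \<longleftrightarrow> (\<forall>W. v \<le> Sup W \<longrightarrow> (\<exists>w\<in>W. u \<le> w))"


section \<open>Normed sets\<close>

text \<open>
  Norms, functors and transformations are total HOL functions; below they are always required to
  be extensional (\<open>undefined\<close> off their domain), so that equality of objects and of morphisms is
  the intended one.
\<close>

datatype ('e, 'v) nset = NSet (carr: "'e set") (snorm: "'e \<Rightarrow> 'v")

text \<open>Morphisms and isomorphisms of \<open>Set//V\<close>, between normed sets of possibly different types.\<close>

definition nset_map :: "('d, 'v::comm_quantale) nset \<Rightarrow> ('e, 'v) nset \<Rightarrow> ('d \<Rightarrow> 'e) \<Rightarrow> bool" where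
  "nset_map A B f \<longleftrightarrow> f \<in> carr A \<rightarrow> carr B \<and> (\<forall>a\<in>carr A. snorm A a \<le> snorm B (f a))"

definition nset_iso :: "('d, 'v::comm_quantale) nset \<Rightarrow> ('e, 'v) nset \<Rightarrow> ('d \<Rightarrow> 'e) \<Rightarrow> bool" where
  "nset_iso A B f \<longleftrightarrow> nset_map A B f \<and>
     (\<exists>g. nset_map B A g \<and> (\<forall>a\<in>carr A. g (f a) = a) \<and> (\<forall>b\<in>carr B. f (g b) = b))"

text \<open>The norm of an arbitrary map, regarded as a morphism of \<open>Set||V\<close>.\<close>

definition map_norm :: "('d, 'v::comm_quantale) nset \<Rightarrow> ('e, 'v) nset \<Rightarrow> ('d \<Rightarrow> 'e) \<Rightarrow> 'v" where
  "map_norm A B f = (INF a\<in>carr A. qhom (snorm A a) (snorm B (f a)))"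


section \<open>Normed categories\<close>

record ('o, 'a, 'v) ncat =
  Obj :: "'o set"
  Arr :: "'a set"
  Dom :: "'a \<Rightarrow> 'o"
  Cod :: "'a \<Rightarrow> 'o"
  Ident :: "'o \<Rightarrow> 'a"
  Comp :: "'a \<Rightarrow> 'a \<Rightarrow> 'a"  \<comment> \<open>\<open>Comp C g f\<close> is \<open>g\<close> after \<open>f\<close>\<close>
  Norm :: "'a \<Rightarrow> 'v"

definition hom :: "('o, 'a, 'v) ncat \<Rightarrow> 'o \<Rightarrow> 'o \<Rightarrow> 'a set" where
  "hom C x y = {f \<in> Arr C. Dom C f = x \<and> Cod C f = y}"

definition homset :: "('o, 'a, 'v) ncat \<Rightarrow> 'o \<Rightarrow> 'o \<Rightarrow> ('a, 'v) nset" where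
  "homset C x y = NSet (hom C x y) (restrict (Norm C) (hom C x y))"

locale normed_category =
  fixes C :: "('o, 'a, 'v::comm_quantale) ncat"
  assumes Dom_Obj: "f \<in> Arr C \<Longrightarrow> Dom C f \<in> Obj C"
    and Cod_Obj: "f \<in> Arr C \<Longrightarrow> Cod C f \<in> Obj C"
    and Ident_hom: "x \<in> Obj C \<Longrightarrow> Ident C x \<in> hom C x x"
    and Comp_hom: "f \<in> hom C x y \<Longrightarrow> g \<in> hom C y z \<Longrightarrow> Comp C g f \<in> hom C x z"
    and Comp_Ident: "f \<in> hom C x y \<Longrightarrow> Comp C f (Ident C x) = f"
    and Ident_Comp: "f \<in> hom C x y \<Longrightarrow> Comp C (Ident C y) f = f"
    and Comp_assoc: "f \<in> hom C x y \<Longrightarrow> g \<in> hom C y z \<Longrightarrow> h \<in> hom C z w \<Longrightarrow>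
                       Comp C h (Comp C g f) = Comp C (Comp C h g) f"
    and Norm_Ident: "x \<in> Obj C \<Longrightarrow> 1 \<le> Norm C (Ident C x)"
    and Norm_Comp: "f \<in> hom C x y \<Longrightarrow> g \<in> hom C y z \<Longrightarrow>
                      Norm C f * Norm C g \<le> Norm C (Comp C g f)"

text \<open>Small normed categories have their objects and arrows taken from the universe itself.\<close>

definition small_ncat :: "('u, 'u, 'v::comm_quantale) ncat \<Rightarrow> bool" where
  "small_ncat C \<longleftrightarrow> normed_category C \<and> small TYPE('u) (Obj C) \<and> small TYPE('u) (Arr C)"

definition dual :: "('o, 'a, 'v) ncat \<Rightarrow> ('o, 'a, 'v) ncat" where
  "dual C = C\<lparr>Dom := Cod C, Cod := Dom C, Comp := \<lambda>g f. Comp C f g\<rparr>"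

definition full_sub :: "('o, 'a, 'v) ncat \<Rightarrow> 'o set \<Rightarrow> ('o, 'a, 'v) ncat" where
  "full_sub C S = C\<lparr>Obj := S, Arr := {f \<in> Arr C. Dom C f \<in> S \<and> Cod C f \<in> S}\<rparr>"

definition k_iso_arrow :: "('o, 'a, 'v::comm_quantale) ncat \<Rightarrow> 'a \<Rightarrow> bool" where
  "k_iso_arrow C f \<longleftrightarrow> f \<in> Arr C \<and> 1 \<le> Norm C f \<and>
     (\<exists>g\<in>hom C (Cod C f) (Dom C f). 1 \<le> Norm C g \<and>
        Comp C g f = Ident C (Dom C f) \<and> Comp C f g = Ident C (Cod C f))"

definition k_iso :: "('o, 'a, 'v::comm_quantale) ncat \<Rightarrow> 'o \<Rightarrow> 'o \<Rightarrow> bool" where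
  "k_iso C x y \<longleftrightarrow> (\<exists>f\<in>hom C x y. k_iso_arrow C f)"


section \<open>Functors\<close>

record ('o, 'a, 'p, 'b) fctr =
  fob :: "'o \<Rightarrow> 'p"
  far :: "'a \<Rightarrow> 'b"

definition normed_functor ::
    "('o, 'a, 'v::comm_quantale) ncat \<Rightarrow> ('p, 'b, 'v) ncat \<Rightarrow> ('o, 'a, 'p, 'b) fctr \<Rightarrow> bool" where
  "normed_functor A Y F \<longleftrightarrow>
     fob F \<in> Obj A \<rightarrow>\<^sub>E Obj Y \<and> far F \<in> Arr A \<rightarrow>\<^sub>E Arr Y \<and>
     (\<forall>f\<in>Arr A. Dom Y (far F f) = fob F (Dom A f) \<and> Cod Y (far F f) = fob F (Cod A f)) \<and>
     (\<forall>x\<in>Obj A. far F (Ident A x) = Ident Y (fob F x)) \<and>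
     (\<forall>f\<in>Arr A. \<forall>g\<in>Arr A. Cod A f = Dom A g \<longrightarrow>
        far F (Comp A g f) = Comp Y (far F g) (far F f)) \<and>
     (\<forall>f\<in>Arr A. Norm A f \<le> Norm Y (far F f))"

definition id_functor :: "('o, 'a, 'v) ncat \<Rightarrow> ('o, 'a, 'o, 'a) fctr" where
  "id_functor A = \<lparr>fob = restrict (\<lambda>x. x) (Obj A), far = restrict (\<lambda>f. f) (Arr A)\<rparr>"

definition comp_functor ::
    "('o, 'a, 'v) ncat \<Rightarrow> ('p, 'b, 'q, 'c) fctr \<Rightarrow> ('o, 'a, 'p, 'b) fctr \<Rightarrow> ('o, 'a, 'q, 'c) fctr"
  where
  "comp_functor A G F =
     \<lparr>fob = restrict (\<lambda>x. fob G (fob F x)) (Obj A), far = restrict (\<lambda>f. far G (far F f)) (Arr A)\<rparr>"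

definition natural_k_iso ::
    "('o, 'a, 'v::comm_quantale) ncat \<Rightarrow> ('p, 'b, 'v) ncat \<Rightarrow>
     ('o, 'a, 'p, 'b) fctr \<Rightarrow> ('o, 'a, 'p, 'b) fctr \<Rightarrow> ('o \<Rightarrow> 'b) \<Rightarrow> bool" where
  "natural_k_iso A Y F G t \<longleftrightarrow>
     (\<forall>x\<in>Obj A. t x \<in> hom Y (fob F x) (fob G x) \<and> k_iso_arrow Y (t x)) \<and>
     (\<forall>f\<in>Arr A. Comp Y (t (Cod A f)) (far F f) = Comp Y (far G f) (t (Dom A f)))"

definition equivalent_ncat ::
    "('o, 'a, 'v::comm_quantale) ncat \<Rightarrow> ('p, 'b, 'v) ncat \<Rightarrow> bool" where
  "equivalent_ncat A Y \<longleftrightarrow>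
     (\<exists>F G s t. normed_functor A Y F \<and> normed_functor Y A G \<and>
        natural_k_iso A A (id_functor A) (comp_functor A G F) s \<and>
        natural_k_iso Y Y (comp_functor Y F G) (id_functor Y) t)"

definition essentially_small :: "'u itself \<Rightarrow> ('o, 'a, 'v::comm_quantale) ncat \<Rightarrow> bool" where
  "essentially_small _ C \<longleftrightarrow>
     (\<exists>B :: ('u, 'u, 'v) ncat. small_ncat B \<and> equivalent_ncat B C)"


section \<open>Presheaves\<close>

text \<open>Arrows of concrete categories carry their domain and codomain.\<close>

datatype ('o, 'f) arrow = Arrow (src: 'o) (act: 'f) (trg: 'o)

text \<open>The category \<open>Set||V\<close> of small normed sets.\<close>

type_synonym ('e, 'v) nmap = "(('e, 'v) nset, 'e \<Rightarrow> 'e) arrow"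

definition SetV :: "(('u, 'v::comm_quantale) nset, ('u, 'v) nmap, 'v) ncat" where
  "SetV =
    (let Ob = {A. small TYPE('u) (carr A) \<and> snorm A \<in> extensional (carr A)} in
     \<lparr>Obj = Ob,
      Arr = {f. src f \<in> Ob \<and> trg f \<in> Ob \<and> act f \<in> carr (src f) \<rightarrow>\<^sub>E carr (trg f)},
      Dom = src,
      Cod = trg,
      Ident = (\<lambda>A. Arrow A (restrict (\<lambda>a. a) (carr A)) A),
      Comp = (\<lambda>g f. Arrow (src f) (compose (carr (src f)) (act g) (act f)) (trg g)),
      Norm = (\<lambda>f. map_norm (src f) (trg f) (act f))\<rparr>)"

text \<open>
  A functor from the dual of \<open>A\<close> to normed sets over \<open>'e\<close>.  Values in \<open>'e = 'u\<close> give presheaves;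
  other element types are only needed for the functors \<open>Y(F-,y)\<close> with \<open>Y\<close> a large category.
\<close>

type_synonym ('o, 'a, 'e, 'v) psh = "('o, 'a, ('e, 'v) nset, ('e, 'v) nmap) fctr"

text \<open>The normed set of natural transformations between two such functors.\<close>

definition Nat ::
    "('o, 'a, 'v::comm_quantale) ncat \<Rightarrow> ('o, 'a, 'd, 'v) psh \<Rightarrow> ('o, 'a, 'e, 'v) psh \<Rightarrow>
     ('o \<Rightarrow> 'd \<Rightarrow> 'e, 'v) nset" where
  "Nat A P Q =
    (let N = {t \<in> \<Pi>\<^sub>E x\<in>Obj A. carr (fob P x) \<rightarrow>\<^sub>E carr (fob Q x).
                \<forall>f\<in>Arr A. \<forall>z\<in>carr (fob P (Cod A f)).
                  t (Dom A f) (act (far P f) z) = act (far Q f) (t (Cod A f) z)} in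
     NSet N (restrict (\<lambda>t. INF x\<in>Obj A. map_norm (fob P x) (fob Q x) (t x)) N))"

definition PSh ::
    "('o, 'a, 'v::comm_quantale) ncat \<Rightarrow>
     (('o, 'a, 'u, 'v) psh, (('o, 'a, 'u, 'v) psh, 'o \<Rightarrow> 'u \<Rightarrow> 'u) arrow, 'v) ncat" where
  "PSh A =
    (let Ob = {P. normed_functor (dual A) SetV P} in
     \<lparr>Obj = Ob,
      Arr = {t. src t \<in> Ob \<and> trg t \<in> Ob \<and> act t \<in> carr (Nat A (src t) (trg t))},
      Dom = src,
      Cod = trg,
      Ident = (\<lambda>P. Arrow P (\<lambda>x\<in>Obj A. restrict (\<lambda>z. z) (carr (fob P x))) P),
      Comp = (\<lambda>t s. Arrow (src s)
                (\<lambda>x\<in>Obj A. compose (carr (fob (src s) x)) (act t x) (act s x)) (trg t)),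
      Norm = (\<lambda>t. snorm (Nat A (src t) (trg t)) (act t))\<rparr>)"

text \<open>The functor \<open>Y(F-,y)\<close> on the dual of \<open>A\<close>, and \<open>A(-,a)\<close> as the case \<open>F = Id\<close>.\<close>

definition hom_presheaf ::
    "('o, 'a, 'v) ncat \<Rightarrow> ('p, 'b, 'v) ncat \<Rightarrow> ('o, 'a, 'p, 'b) fctr \<Rightarrow> 'p \<Rightarrow>
     ('o, 'a, 'b, 'v) psh" where
  "hom_presheaf A Y F y =
    \<lparr>fob = (\<lambda>x\<in>Obj A. homset Y (fob F x) y),
     far = (\<lambda>f\<in>Arr A. Arrow (homset Y (fob F (Cod A f)) y)
              (\<lambda>g\<in>hom Y (fob F (Cod A f)) y. Comp Y g (far F f))
              (homset Y (fob F (Dom A f)) y))\<rparr>"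

definition representable :: "('o, 'a, 'v) ncat \<Rightarrow> 'o \<Rightarrow> ('o, 'a, 'a, 'v) psh" where
  "representable A a = hom_presheaf A A (id_functor A) a"


section \<open>Normed and weighted colimits\<close>

text \<open>A sequence is a functor from the ordered set of natural numbers; \<open>s m n\<close> matters only for
  \<open>m \<le> n\<close>.\<close>

definition sequence ::
    "('o, 'a, 'v) ncat \<Rightarrow> (nat \<Rightarrow> 'o) \<Rightarrow> (nat \<Rightarrow> nat \<Rightarrow> 'a) \<Rightarrow> bool" where
  "sequence C x s \<longleftrightarrow>
     (\<forall>n. x n \<in> Obj C) \<and> (\<forall>m n. m \<le> n \<longrightarrow> s m n \<in> hom C (x m) (x n)) \<and>
     (\<forall>n. s n n = Ident C (x n)) \<and>
     (\<forall>m n p. m \<le> n \<longrightarrow> n \<le> p \<longrightarrow> s m p = Comp C (s n p) (s m n))"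

definition cauchy :: "('o, 'a, 'v::comm_quantale) ncat \<Rightarrow> (nat \<Rightarrow> nat \<Rightarrow> 'a) \<Rightarrow> bool" where
  "cauchy C s \<longleftrightarrow> 1 \<le> (SUP N. INF m\<in>{N..}. INF n\<in>{m..}. Norm C (s m n))"

definition cocone ::
    "('o, 'a, 'v) ncat \<Rightarrow> (nat \<Rightarrow> 'o) \<Rightarrow> (nat \<Rightarrow> nat \<Rightarrow> 'a) \<Rightarrow> 'o \<Rightarrow> (nat \<Rightarrow> 'a) \<Rightarrow> bool" where
  "cocone C x s c \<gamma> \<longleftrightarrow>
     c \<in> Obj C \<and> (\<forall>n. \<gamma> n \<in> hom C (x n) c) \<and> (\<forall>m n. m \<le> n \<longrightarrow> Comp C (\<gamma> n) (s m n) = \<gamma> m)"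

definition colimit_cocone ::
    "('o, 'a, 'v) ncat \<Rightarrow> (nat \<Rightarrow> 'o) \<Rightarrow> (nat \<Rightarrow> nat \<Rightarrow> 'a) \<Rightarrow> 'o \<Rightarrow> (nat \<Rightarrow> 'a) \<Rightarrow> bool" where
  "colimit_cocone C x s c \<gamma> \<longleftrightarrow>
     cocone C x s c \<gamma> \<and>
     (\<forall>d \<delta>. cocone C x s d \<delta> \<longrightarrow> (\<exists>!h. h \<in> hom C c d \<and> (\<forall>n. Comp C h (\<gamma> n) = \<delta> n)))"

definition normed_colimit ::
    "('o, 'a, 'v::comm_quantale) ncat \<Rightarrow> (nat \<Rightarrow> 'o) \<Rightarrow> (nat \<Rightarrow> nat \<Rightarrow> 'a) \<Rightarrow> 'o \<Rightarrow> bool" where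
  "normed_colimit C x s c \<longleftrightarrow>
     (\<exists>\<gamma>. colimit_cocone C x s c \<gamma> \<and>
        (\<forall>f\<in>Arr C. Dom C f = c \<longrightarrow>
           Norm C f = (SUP N. INF n\<in>{N..}. Norm C (Comp C f (\<gamma> n)))))"

text \<open>The final conjunct is naturality in \<open>y\<close>: post-composition with \<open>g\<close> on both sides.\<close>

definition weighted_colimit ::
    "('o, 'a, 'v::comm_quantale) ncat \<Rightarrow> ('p, 'b, 'v) ncat \<Rightarrow> ('o, 'a, 'p, 'b) fctr \<Rightarrow>
     ('o, 'a, 'd, 'v) psh \<Rightarrow> 'p \<Rightarrow> bool" where
  "weighted_colimit A Y F P c \<longleftrightarrow>
     c \<in> Obj Y \<and>
     (\<exists>\<theta>. (\<forall>y\<in>Obj Y. nset_iso (homset Y c y) (Nat A P (hom_presheaf A Y F y)) (\<theta> y)) \<and>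
          (\<forall>g\<in>Arr Y. \<forall>f\<in>hom Y c (Dom Y g). \<forall>a\<in>Obj A. \<forall>z\<in>carr (fob P a).
             \<theta> (Cod Y g) (Comp Y g f) a z = Comp Y g (\<theta> (Dom Y g) f a z)))"


section \<open>The cocompletion\<close>

text \<open>\<open>Phi_weights A\<close> is \<open>\<Phi>[A]\<close>.\<close>

definition Phi_weights :: "('u, 'u, 'v::comm_quantale) ncat \<Rightarrow> ('u, 'u, 'u, 'v) psh set" where
  "Phi_weights A =
     {P. \<exists>x s. sequence (PSh A) x s \<and> cauchy (PSh A) s \<and>
           (\<forall>n. \<exists>a\<in>Obj A. x n = representable A a) \<and> normed_colimit (PSh A) x s P}"

definition replete :: "('o, 'a, 'v::comm_quantale) ncat \<Rightarrow> 'o set \<Rightarrow> bool" where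
  "replete C S \<longleftrightarrow> (\<forall>x\<in>S. \<forall>y\<in>Obj C. k_iso C x y \<longrightarrow> y \<in> S)"

definition Phi_closed ::
    "('u, 'u, 'v::comm_quantale) ncat \<Rightarrow> ('u, 'u, 'u, 'v) psh set \<Rightarrow> bool" where
  "Phi_closed X S \<longleftrightarrow>
     (\<forall>(A :: ('u, 'u, 'v) ncat) F P c.
        small_ncat A \<longrightarrow> normed_functor A (PSh X) F \<longrightarrow> (\<forall>a\<in>Obj A. fob F a \<in> S) \<longrightarrow>
        P \<in> Phi_weights A \<longrightarrow> weighted_colimit A (PSh X) F P c \<longrightarrow> c \<in> S)"

definition Phi_obj :: "('u, 'u, 'v::comm_quantale) ncat \<Rightarrow> ('u, 'u, 'u, 'v) psh set" where
  "Phi_obj X = \<Inter>{S. S \<subseteq> Obj (PSh X) \<and> representable X ` Obj X \<subseteq> S \<and>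
                     replete (PSh X) S \<and> Phi_closed X S}"

definition Phi_cat ::
    "('u, 'u, 'v::comm_quantale) ncat \<Rightarrow>
     (('u, 'u, 'u, 'v) psh, (('u, 'u, 'u, 'v) psh, 'u \<Rightarrow> 'u \<Rightarrow> 'u) arrow, 'v) ncat" where
  "Phi_cat X = full_sub (PSh X) (Phi_obj X)"

end

theory Submission
  imports Defs
begin

text \<open>
  Every presheaf in \<open>\<Phi>(X)\<close> has at each object of \<open>X\<close> at most as many elements as a fixed infinite
  small set \<open>K\<close> containing the arrows of \<open>X\<close>: the presheaves with this bound are replete, contain the
  representables and are closed under \<open>\<Phi>\<close>-colimits.  The last point holds because a weight \<open>P\<close> in
  \<open>\<Phi>[A]\<close>, being a colimit of a sequence of representables \<open>A(-,a\<^sub>n)\<close>, is covered by countably many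
  of them, so a \<open>P\<close>-weighted colimit of \<open>F\<close> is covered by the countably many presheaves \<open>F a\<^sub>n\<close>.
  Both coverings come from the same argument: the elements reached form a subpresheaf, through which
  the universal property factors the identity.  Up to \<open>k\<close>-isomorphism the bounded presheaves have
  their elements in \<open>K\<close>, and there is only a small set of those.
\<close>

section \<open>Small sets\<close>

text \<open>\<open>B\<close> has at most as many elements as the image of \<open>A\<close>, hence as
  \<open>A\<close> itself. Most smallness proofs below take this form: every element is written as
  the value of a code from a small set, and no injectivity has to be checked.\<close>

lemma small_image_subset:
  assumes "small TYPE('u) A" and "B \<subseteq> f ` A"
  shows "small TYPE('u) B"
  using assms unfolding small_def
  by (meson card_of_image card_of_mono1 ordLeq_ordLess_trans ordLeq_transitive)

lemma small_image: "small TYPE('u) A \<Longrightarrow> small TYPE('u) (f ` A)"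
  by (erule small_image_subset) (rule order.refl)

lemma small_subset: "small TYPE('u) A \<Longrightarrow> B \<subseteq> A \<Longrightarrow> small TYPE('u) B"
  by (rule small_image_subset[where f = id]) auto

text \<open>Moves a small set of any type into the universe type \<open>'u\<close>, where
  \<open>grothendieck_universe\<close> states its closure conditions and where a
  \<open>small_ncat\<close> must have its objects and arrows.\<close>

lemma small_inj:
  assumes "small TYPE('u) (A :: 'e set)"
  obtains f :: "'e \<Rightarrow> 'u" where "inj_on f A"
  using assms unfolding small_def
  by (meson card_of_ordLeq ordLess_imp_ordLeq)

section \<open>Closure properties of small sets in a universe\<close>

context
  assumes universe: "grothendieck_universe TYPE('u)"
begin

lemma infinite_universe: "infinite (UNIV :: 'u set)"
  using universe unfolding grothendieck_universe_def by (meson finite_subset top_greatest)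

lemma small_Un: "small TYPE('u) A \<Longrightarrow> small TYPE('u) B \<Longrightarrow> small TYPE('u) (A \<union> B)"
  using infinite_universe unfolding small_def by (rule card_of_Un_ordLess_infinite)

text \<open>Both factors embed into their disjoint sum, and an infinite set is equinumerous with its
  square. Only a finite sum needs a separate argument, and there the product is finite too.\<close>

lemma small_Times:
  assumes "small TYPE('u) A" and "small TYPE('u) B"
  shows "small TYPE('u) (A \<times> B)"
proof (cases "finite (A <+> B)")
  case True
  then have "finite (A \<times> B)"
    by (simp add: finite_Plus_iff)
  then show ?thesis
    using infinite_universe finite_ordLess_infinite[OF card_of_Well_order card_of_Well_order]
    unfolding small_def by (simp add: Field_card_of)
next
  case False
  have "small TYPE('u) (Inl ` A \<union> Inr ` B)"
    using assms by (intro small_Un) (blast intro: small_image_subset)+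
  then have "small TYPE('u) (A <+> B)"
    by (simp add: Plus_def)
  then have "small TYPE('u) ((A <+> B) \<times> (A <+> B))"
    using card_of_Times_same_infinite[OF False] ordIso_ordLess_trans unfolding small_def by blast
  then show ?thesis
    by (rule small_image_subset[where f = "\<lambda>(x, y). (projl x, projr y)"])
      (force simp: image_iff)
qed

text \<open>The universe condition concerns subsets of \<open>'u\<close> only, so the power set is
  formed for an injective copy of \<open>A\<close> and brought back by taking preimages.\<close>

lemma small_Pow:
  assumes A: "small TYPE('u) A"
  shows "small TYPE('u) (Pow A)"
proof -
  obtain f :: "_ \<Rightarrow> 'u" where f: "inj_on f A"
    using A by (rule small_inj)
  have "small TYPE('u) (f ` A)"
    using A by (rule small_image)
  then have "small TYPE('u) (Pow (f ` A))"
    using universe by (simp add: grothendieck_universe_def)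
  moreover have "Pow A \<subseteq> (\<lambda>B. {a \<in> A. f a \<in> B}) ` Pow (f ` A)"
  proof
    fix B assume "B \<in> Pow A"
    then have "B = {a \<in> A. f a \<in> f ` B}" and "f ` B \<in> Pow (f ` A)"
      using f by (auto dest: inj_onD)
    then show "B \<in> (\<lambda>B. {a \<in> A. f a \<in> B}) ` Pow (f ` A)"
      by blast
  qed
  ultimately show ?thesis
    by (rule small_image_subset)
qed

text \<open>A function is recovered from its domain and its graph. The domain varies because the
  carriers of the presheaves counted later are different subsets of one small set.\<close>

lemma small_partial_functions:
  assumes "small TYPE('u) A" and "small TYPE('u) B"
  shows "small TYPE('u) {(D, f). D \<subseteq> A \<and> f \<in> D \<rightarrow>\<^sub>E B}"
proof (rule small_image_subset)
  show "small TYPE('u) (Pow A \<times> Pow (A \<times> B))"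
    using assms by (intro small_Times small_Pow)
  let ?fun = "\<lambda>(D, G). (D, \<lambda>a\<in>D. THE b. (a, b) \<in> G)"
  show "{(D, f). D \<subseteq> A \<and> f \<in> D \<rightarrow>\<^sub>E B} \<subseteq> ?fun ` (Pow A \<times> Pow (A \<times> B))"
  proof clarify
    fix D f assume "D \<subseteq> A" and f: "f \<in> D \<rightarrow>\<^sub>E B"
    then have "(D, (\<lambda>a. (a, f a)) ` D) \<in> Pow A \<times> Pow (A \<times> B)"
      by auto
    \<comment> \<open>Off \<open>D\<close> both sides are \<open>undefined\<close>, so the graph
      determines the whole total function.\<close>
    moreover have "f = (\<lambda>a\<in>D. THE b. (a, b) \<in> (\<lambda>a. (a, f a)) ` D)"
    proof (rule extensionalityI)
      fix a assume a: "a \<in> D"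
      then have "(THE b. (a, b) \<in> (\<lambda>a. (a, f a)) ` D) = f a"
        by (intro the_equality) auto
      with a show "f a = (\<lambda>a\<in>D. THE b. (a, b) \<in> (\<lambda>a. (a, f a)) ` D) a"
        by simp
    qed (use f in \<open>auto simp: PiE_def\<close>)
    ultimately show "(D, f) \<in> ?fun ` (Pow A \<times> Pow (A \<times> B))"
      by (intro rev_image_eqI) auto
  qed
qed

lemma small_PiE:
  assumes "small TYPE('u) A" and "small TYPE('u) B"
  shows "small TYPE('u) (A \<rightarrow>\<^sub>E B)"
proof (rule small_image_subset[OF small_partial_functions[OF assms], where f = snd], rule subsetI)
  fix f assume "f \<in> A \<rightarrow>\<^sub>E B"
  then show "f \<in> snd ` {(D, f). D \<subseteq> A \<and> f \<in> D \<rightarrow>\<^sub>E B}"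
    by (intro rev_image_eqI[of "(A, f)"]) simp_all
qed

end


section \<open>Quantales and normed categories\<close>

lemma quantale_mult_right_mono: "a \<le> b \<Longrightarrow> a * v \<le> b * v" for a b v :: "'v::comm_quantale"
  by (meson order.refl order.trans qhom_adjoint)

lemma quantale_mult_mono: "a \<le> b \<Longrightarrow> u \<le> v \<Longrightarrow> a * u \<le> b * v" for a b u v :: "'v::comm_quantale"
  by (metis mult.commute order.trans quantale_mult_right_mono)

text \<open>The adjunction removes both the infimum and the internal homs: a lower bound for the
  norm of a map becomes an inequality at each element, the form in which norms of maps and
  transformations are estimated below.\<close>

lemma le_map_norm_iff:
  "v \<le> map_norm A B f \<longleftrightarrow> (\<forall>a\<in>carr A. v * snorm A a \<le> snorm B (f a))"
  by (simp add: map_norm_def le_INF_iff qhom_adjoint)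

lemma homD: "f \<in> hom C x y \<Longrightarrow> f \<in> Arr C \<and> Dom C f = x \<and> Cod C f = y"
  by (simp add: hom_def)

lemma k_iso_iff:
  "k_iso C x y \<longleftrightarrow> (\<exists>f\<in>hom C x y. \<exists>g\<in>hom C y x. 1 \<le> Norm C f \<and> 1 \<le> Norm C g \<and>
     Comp C g f = Ident C x \<and> Comp C f g = Ident C y)"
  unfolding k_iso_def k_iso_arrow_def by (auto simp: hom_def)

lemma k_iso_arrowI:
  assumes "f \<in> hom C x y" "g \<in> hom C y x" "1 \<le> Norm C f" "1 \<le> Norm C g"
    "Comp C g f = Ident C x" "Comp C f g = Ident C y"
  shows "k_iso_arrow C f"
  using assms unfolding k_iso_arrow_def by (auto simp: hom_def)

lemma full_sub_simps [simp]:
  "Obj (full_sub C S) = S"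
  "Arr (full_sub C S) = {f \<in> Arr C. Dom C f \<in> S \<and> Cod C f \<in> S}"
  "Dom (full_sub C S) = Dom C" "Cod (full_sub C S) = Cod C"
  "Ident (full_sub C S) = Ident C" "Comp (full_sub C S) = Comp C" "Norm (full_sub C S) = Norm C"
  by (simp_all add: full_sub_def)

lemma hom_full_sub: "hom (full_sub C S) x y = (if x \<in> S \<and> y \<in> S then hom C x y else {})"
  by (auto simp: hom_def)

lemma k_iso_full_sub: "x \<in> S \<Longrightarrow> y \<in> S \<Longrightarrow> k_iso (full_sub C S) x y = k_iso C x y"
  by (simp add: k_iso_iff hom_full_sub)

section \<open>Full subcategories and a criterion for essential smallness\<close>

context normed_category
begin

lemma hom_Obj: "f \<in> hom C x y \<Longrightarrow> x \<in> Obj C \<and> y \<in> Obj C"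
  using Dom_Obj Cod_Obj by (auto simp: hom_def)

lemma normed_category_full_sub:
  assumes "S \<subseteq> Obj C"
  shows "normed_category (full_sub C S)"
proof unfold_locales
  fix x assume "x \<in> Obj (full_sub C S)"
  then show "Ident (full_sub C S) x \<in> hom (full_sub C S) x x" "1 \<le> Norm (full_sub C S) (Ident (full_sub C S) x)"
    using assms Ident_hom Norm_Ident by (auto simp: hom_full_sub)
next
  fix f x y assume "f \<in> hom (full_sub C S) x y"
  then have f: "f \<in> hom C x y" "x \<in> S" "y \<in> S"
    by (simp_all add: hom_full_sub split: if_splits)
  then show "Comp (full_sub C S) f (Ident (full_sub C S) x) = f"
    "Comp (full_sub C S) (Ident (full_sub C S) y) f = f"
    by (simp_all add: Comp_Ident Ident_Comp)
  fix g z assume "g \<in> hom (full_sub C S) y z"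
  then have g: "g \<in> hom C y z" "z \<in> S"
    by (simp_all add: hom_full_sub split: if_splits)
  show "Comp (full_sub C S) g f \<in> hom (full_sub C S) x z"
    using f g by (simp add: hom_full_sub Comp_hom)
  show "Norm (full_sub C S) f * Norm (full_sub C S) g \<le> Norm (full_sub C S) (Comp (full_sub C S) g f)"
    using Norm_Comp[OF f(1) g(1)] by simp
  fix h w assume "h \<in> hom (full_sub C S) z w"
  then have "h \<in> hom C z w"
    by (simp add: hom_full_sub split: if_splits)
  then show "Comp (full_sub C S) h (Comp (full_sub C S) g f) = Comp (full_sub C S) (Comp (full_sub C S) h g) f"
    using Comp_assoc[OF f(1) g(1)] by simp
qed (auto)


text \<open>The full subcategory on the representatives \<open>R\<close> is copied into
  \<open>'u\<close> by injections \<open>e\<close> on objects and \<open>d\<close> on arrows.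
  Decoding is a functor from the copy to \<open>C\<close>; conjugation with chosen k-isomorphisms
  onto the representatives gives a functor back, inverse up to natural k-isomorphism.\<close>

lemma essentially_smallI:
  assumes R: "R \<subseteq> Obj C" and skeleton: "\<And>x. x \<in> Obj C \<Longrightarrow> \<exists>r\<in>R. k_iso C x r"
    and small_R: "small TYPE('u) R" and small_Arr: "small TYPE('u) (Arr (full_sub C R))"
  shows "essentially_small TYPE('u) C"
proof -
  let ?AR = "Arr (full_sub C R)"
  obtain e :: "_ \<Rightarrow> 'u" where "inj_on e R"
    using small_R by (rule small_inj)
  then obtain e' where e'[simp]: "\<And>x. x \<in> R \<Longrightarrow> e' (e x) = x"
    by (meson inv_into_f_f)
  obtain d :: "_ \<Rightarrow> 'u" where "inj_on d ?AR"
    using small_Arr by (rule small_inj)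
  then obtain d' where d': "\<And>f. f \<in> ?AR \<Longrightarrow> d' (d f) = f"
    by (meson inv_into_f_f)
  have d'_hom[simp]: "d' (d f) = f" if "f \<in> hom C x y" "x \<in> R" "y \<in> R" for f x y
    using that by (auto simp: hom_def intro: d')
  \<comment> \<open>The structure of the full subcategory on \<open>R\<close>, carried along the
    codings; \<open>e'\<close> and \<open>d'\<close> decode.\<close>
  define B where "B = \<lparr>Obj = e ` R, Arr = d ` ?AR, Dom = \<lambda>f. e (Dom C (d' f)),
    Cod = \<lambda>f. e (Cod C (d' f)), Ident = \<lambda>x. d (Ident C (e' x)),
    Comp = \<lambda>g f. d (Comp C (d' g) (d' f)), Norm = \<lambda>f. Norm C (d' f)\<rparr>"
  have B[simp]: "Obj B = e ` R" "Arr B = d ` ?AR" "Ident B = (\<lambda>x. d (Ident C (e' x)))"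
    "Comp B = (\<lambda>g f. d (Comp C (d' g) (d' f)))" "Norm B = (\<lambda>f. Norm C (d' f))"
    "Dom B = (\<lambda>f. e (Dom C (d' f)))" "Cod B = (\<lambda>f. e (Cod C (d' f)))"
    by (simp_all add: B_def)
  have AR: "f \<in> ?AR \<longleftrightarrow> (\<exists>x\<in>R. \<exists>y\<in>R. f \<in> hom C x y)" for f
    by (auto simp: hom_def)
  have homB: "f \<in> hom B p q \<longleftrightarrow> (\<exists>x\<in>R. \<exists>y\<in>R. \<exists>g\<in>hom C x y. p = e x \<and> q = e y \<and> f = d g)" for f p q
  proof
    assume "f \<in> hom B p q"
    then obtain g where "g \<in> ?AR" "f = d g" "p = e (Dom C g)" "q = e (Cod C g)"
      by (auto simp: hom_def d')
    then show "\<exists>x\<in>R. \<exists>y\<in>R. \<exists>g\<in>hom C x y. p = e x \<and> q = e y \<and> f = d g"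
      by (intro bexI[of _ "Dom C g"] bexI[of _ "Cod C g"] bexI[of _ g]) (auto simp: hom_def)
  next
    assume "\<exists>x\<in>R. \<exists>y\<in>R. \<exists>g\<in>hom C x y. p = e x \<and> q = e y \<and> f = d g"
    then show "f \<in> hom B p q"
      by (auto simp: hom_def d')
  qed
  have homB_I: "d g \<in> hom B (e x) (e y)" if "g \<in> hom C x y" "x \<in> R" "y \<in> R" for g x y
    using that unfolding homB by blast
  have Ident_R: "Ident C x \<in> hom C x x" if "x \<in> R" for x
    using that R Ident_hom by blast
  have B_cat: "normed_category B"
  proof unfold_locales
    fix f assume "f \<in> Arr B"
    then show "Dom B f \<in> Obj B" "Cod B f \<in> Obj B" by (auto simp: d')
  next
    fix p assume "p \<in> Obj B"
    then obtain x where x: "x \<in> R" "p = e x" by auto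
    show "Ident B p \<in> hom B p p"
      using x homB_I[OF Ident_R] by simp
    show "1 \<le> Norm B (Ident B p)"
      using x R Norm_Ident d'_hom[OF Ident_R] by auto
  next
    fix f p q assume "f \<in> hom B p q"
    then obtain x y f' where f: "x \<in> R" "y \<in> R" "f' \<in> hom C x y" "p = e x" "q = e y" "f = d f'"
      unfolding homB by blast
    then show "Comp B f (Ident B p) = f" "Comp B (Ident B q) f = f"
      using d'_hom[OF Ident_R] by (auto simp: Comp_Ident Ident_Comp)
    fix g r assume "g \<in> hom B q r"
    then obtain y' z g' where g: "y' \<in> R" "z \<in> R" "g' \<in> hom C y' z" "q = e y'" "r = e z" "g = d g'"
      unfolding homB by blast
    \<comment> \<open>Codes determine objects, so composable codes come from composable
      arrows.\<close>
    with f have "y' = y" by (metis e')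
    with g have g': "g' \<in> hom C y z" by simp
    note c = Comp_hom[OF f(3) g']
    show "Comp B g f \<in> hom B p r"
      using f g g' c by (auto intro: homB_I)
    show "Norm B f * Norm B g \<le> Norm B (Comp B g f)"
      using f g g' c Norm_Comp by auto
    fix h t assume "h \<in> hom B r t"
    then obtain z' w h' where h: "z' \<in> R" "w \<in> R" "h' \<in> hom C z' w" "r = e z'" "t = e w" "h = d h'"
      unfolding homB by blast
    with g have "z' = z" by (metis e')
    with h have h': "h' \<in> hom C z w" by simp
    show "Comp B h (Comp B g f) = Comp B (Comp B h g) f"
      using f g g' h h' c Comp_hom[OF g' h'] Comp_assoc[OF f(3) g' h'] by auto
  qed
  have "small TYPE('u) (Obj B)" "small TYPE('u) (Arr B)"
    using small_R small_Arr by (auto intro: small_image)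
  with B_cat have small_B: "small_ncat B"
    by (simp add: small_ncat_def)
  \<comment> \<open>The choice is not normalised on \<open>R\<close>: \<open>r x\<close> may differ
    from \<open>x\<close> even when \<open>x\<close> is in \<open>R\<close>. The natural
    isomorphisms on both sides of the equivalence are therefore built from \<open>u\<close> and
    \<open>w\<close>.\<close>
  obtain r u w where r: "\<And>x. x \<in> Obj C \<Longrightarrow> r x \<in> R"
    and u: "\<And>x. x \<in> Obj C \<Longrightarrow> u x \<in> hom C x (r x)" and w: "\<And>x. x \<in> Obj C \<Longrightarrow> w x \<in> hom C (r x) x"
    and Norm_u: "\<And>x. x \<in> Obj C \<Longrightarrow> 1 \<le> Norm C (u x)" and Norm_w: "\<And>x. x \<in> Obj C \<Longrightarrow> 1 \<le> Norm C (w x)"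
    and wu: "\<And>x. x \<in> Obj C \<Longrightarrow> Comp C (w x) (u x) = Ident C x"
    and uw: "\<And>x. x \<in> Obj C \<Longrightarrow> Comp C (u x) (w x) = Ident C (r x)"
  proof -
    have "\<forall>x\<in>Obj C. \<exists>r u w. r \<in> R \<and> u \<in> hom C x r \<and> w \<in> hom C r x \<and> 1 \<le> Norm C u \<and> 1 \<le> Norm C w \<and>
        Comp C w u = Ident C x \<and> Comp C u w = Ident C r"
      using skeleton by (simp add: k_iso_iff) blast
    from bchoice[OF this] obtain r where "\<forall>x\<in>Obj C. \<exists>u w. r x \<in> R \<and> u \<in> hom C x (r x) \<and>
        w \<in> hom C (r x) x \<and> 1 \<le> Norm C u \<and> 1 \<le> Norm C w \<and>
        Comp C w u = Ident C x \<and> Comp C u w = Ident C (r x)" ..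
    from bchoice[OF this] obtain u where "\<forall>x\<in>Obj C. \<exists>w. r x \<in> R \<and> u x \<in> hom C x (r x) \<and>
        w \<in> hom C (r x) x \<and> 1 \<le> Norm C (u x) \<and> 1 \<le> Norm C w \<and>
        Comp C w (u x) = Ident C x \<and> Comp C (u x) w = Ident C (r x)" ..
    from bchoice[OF this] obtain w where "\<forall>x\<in>Obj C. r x \<in> R \<and> u x \<in> hom C x (r x) \<and>
        w x \<in> hom C (r x) x \<and> 1 \<le> Norm C (u x) \<and> 1 \<le> Norm C (w x) \<and>
        Comp C (w x) (u x) = Ident C x \<and> Comp C (u x) (w x) = Ident C (r x)" ..
    then show thesis
      by (intro that[of r u w]) simp_all
  qed
  define F where "F = \<lparr>fob = restrict e' (Obj B), far = restrict d' (Arr B)\<rparr>"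
  define conj where "conj f = Comp C (u (Cod C f)) (Comp C f (w (Dom C f)))" for f
  define G where "G = \<lparr>fob = (\<lambda>x\<in>Obj C. e (r x)), far = (\<lambda>f\<in>Arr C. d (conj f))\<rparr>"
  have conj: "conj f \<in> hom C (r x) (r y)" "Norm C f \<le> Norm C (conj f)"
    "Comp C (w y) (conj f) = Comp C f (w x)" "Comp C (conj f) (u x) = Comp C (u y) f"
    if f: "f \<in> hom C x y" for f x y
  proof -
    have xy: "x \<in> Obj C" "y \<in> Obj C" using hom_Obj[OF f] by auto
    have c: "conj f = Comp C (u y) (Comp C f (w x))" using f by (simp add: conj_def hom_def)
    note fw = Comp_hom[OF w[OF xy(1)] f] and uf = Comp_hom[OF f u[OF xy(2)]]
    show "conj f \<in> hom C (r x) (r y)"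
      unfolding c using fw u[OF xy(2)] by (rule Comp_hom)
    \<comment> \<open>Here the isomorphisms have to be k-morphisms: as \<open>u y\<close> and
      \<open>w x\<close> have norm at least the unit, conjugation does not lower norms.\<close>
    have "1 * Norm C f * 1 \<le> Norm C (w x) * Norm C f * Norm C (u y)"
      using Norm_u[OF xy(2)] Norm_w[OF xy(1)] by (intro quantale_mult_mono) auto
    also have "\<dots> \<le> Norm C (conj f)"
      unfolding c using Norm_Comp[OF w[OF xy(1)] f] Norm_Comp[OF fw u[OF xy(2)]]
      by (meson order.trans quantale_mult_right_mono)
    finally show "Norm C f \<le> Norm C (conj f)" by simp
    show "Comp C (w y) (conj f) = Comp C f (w x)"
      unfolding c Comp_assoc[OF fw u[OF xy(2)] w[OF xy(2)]] wu[OF xy(2)] by (rule Ident_Comp[OF fw])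
    have "Comp C (conj f) (u x) = Comp C (Comp C (Comp C (u y) f) (w x)) (u x)"
      unfolding c Comp_assoc[OF w[OF xy(1)] f u[OF xy(2)]] ..
    also have "\<dots> = Comp C (u y) f"
      unfolding Comp_assoc[OF u[OF xy(1)] w[OF xy(1)] uf, symmetric] wu[OF xy(1)] by (rule Comp_Ident[OF uf])
    finally show "Comp C (conj f) (u x) = Comp C (u y) f" .
  qed
  have conj_id: "conj (Ident C x) = Ident C (r x)" if x: "x \<in> Obj C" for x
    using homD[OF Ident_hom[OF x]] Ident_Comp[OF w[OF x]] uw[OF x] by (simp add: conj_def)
  have conj_Comp: "conj (Comp C g f) = Comp C (conj g) (conj f)"
    if f: "f \<in> hom C x y" and g: "g \<in> hom C y z" for f g x y z
  proof -
    have xyz: "x \<in> Obj C" "y \<in> Obj C" "z \<in> Obj C" using hom_Obj[OF f] hom_Obj[OF g] by auto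
    note gf = Comp_hom[OF f g] and fw = Comp_hom[OF w[OF xyz(1)] f]
    have "conj (Comp C g f) = Comp C (u z) (Comp C g (Comp C f (w x)))"
      using homD[OF gf] Comp_assoc[OF w[OF xyz(1)] f g] by (simp add: conj_def)
    \<comment> \<open>Naturality of \<open>w\<close> replaces \<open>f\<close> after
      \<open>w x\<close> by \<open>w y\<close> after \<open>conj f\<close>; what remains in front of
      \<open>conj f\<close> is \<open>conj g\<close>.\<close>
    also have "\<dots> = Comp C (u z) (Comp C g (Comp C (w y) (conj f)))"
      using conj(3)[OF f] by simp
    also have "\<dots> = Comp C (u z) (Comp C (Comp C g (w y)) (conj f))"
      using Comp_assoc[OF conj(1)[OF f] w[OF xyz(2)] g] by simp
    also have "\<dots> = Comp C (conj g) (conj f)"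
      using Comp_assoc[OF conj(1)[OF f] Comp_hom[OF w[OF xyz(2)] g] u[OF xyz(3)]] homD[OF g]
      by (simp add: conj_def)
    finally show ?thesis .
  qed
  have "normed_functor B C F"
    unfolding normed_functor_def
  proof (intro conjI ballI impI)
    show "fob F \<in> Obj B \<rightarrow>\<^sub>E Obj C"
      using R by (auto simp: F_def)
    show "far F \<in> Arr B \<rightarrow>\<^sub>E Arr C"
      by (auto simp: F_def d')
    fix f assume "f \<in> Arr B"
    then obtain f' where f: "f' \<in> ?AR" "f = d f'" by auto
    then show "Dom C (far F f) = fob F (Dom B f)" "Cod C (far F f) = fob F (Cod B f)"
      "Norm B f \<le> Norm C (far F f)"
      by (auto simp: F_def d')
    fix g assume "g \<in> Arr B" and eq: "Cod B f = Dom B g"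
    then obtain g' where g: "g' \<in> ?AR" "g = d g'" by auto
    then have "e (Cod C f') = e (Dom C g')"
      using f eq by (simp add: d' del: full_sub_simps)
    then have "e' (e (Cod C f')) = e' (e (Dom C g'))"
      by simp
    then have "Cod C f' = Dom C g'"
      using f g by simp
    then have "Comp C g' f' \<in> ?AR"
      using Comp_hom[of f' "Dom C f'" "Cod C f'" g' "Cod C g'"] f g by (simp add: hom_def)
    then show "far F (Comp B g f) = Comp C (far F g) (far F f)"
      using f g by (simp add: F_def d' del: full_sub_simps)
  next
    fix p assume "p \<in> Obj B"
    then obtain x where x: "x \<in> R" "p = e x" by auto
    then have "Ident C x \<in> ?AR" using Ident_R by (auto simp: hom_def)
    with x show "far F (Ident B p) = Ident C (fob F p)"
      by (simp add: F_def d' del: full_sub_simps)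
  qed
  moreover have "normed_functor C B G"
    unfolding normed_functor_def
  proof (intro conjI ballI impI)
    show "fob G \<in> Obj C \<rightarrow>\<^sub>E Obj B"
      using r by (auto simp: G_def)
    have hom_conj: "far G f \<in> hom B (fob G (Dom C f)) (fob G (Cod C f))" if "f \<in> Arr C" for f
      using that conj(1)[of f "Dom C f" "Cod C f"] homB_I r Dom_Obj Cod_Obj by (simp add: G_def hom_def)
    then show "far G \<in> Arr C \<rightarrow>\<^sub>E Arr B"
      by (auto simp: hom_def) (simp add: G_def)
    fix f assume f: "f \<in> Arr C"
    then show "Dom B (far G f) = fob G (Dom C f)" "Cod B (far G f) = fob G (Cod C f)"
      using homD[OF hom_conj[OF f]] by simp_all
    have f': "f \<in> hom C (Dom C f) (Cod C f)" using f by (simp add: hom_def)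
    have d'_f: "d' (d (conj f)) = conj f"
      using conj(1)[OF f'] hom_Obj[OF f'] by (intro d'_hom[of _ "r (Dom C f)" "r (Cod C f)"]) (simp_all add: r)
    then show "Norm C f \<le> Norm B (far G f)"
      using f conj(2)[OF f'] by (simp add: G_def)
    fix g assume g: "g \<in> Arr C" and eq: "Cod C f = Dom C g"
    then have g': "g \<in> hom C (Cod C f) (Cod C g)" by (simp add: hom_def)
    have "d' (d (conj g)) = conj g"
      using conj(1)[OF g'] hom_Obj[OF g'] by (intro d'_hom[of _ "r (Cod C f)" "r (Cod C g)"]) (simp_all add: r)
    then show "far G (Comp C g f) = Comp B (far G g) (far G f)"
      using homD[OF Comp_hom[OF f' g']] f g d'_f conj_Comp[OF f' g'] by (simp add: G_def)
  next
    fix x assume x: "x \<in> Obj C"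
    then show "far G (Ident C x) = Ident B (fob G x)"
      using homD[OF Ident_hom[OF x]] conj_id[OF x] r[OF x] by (simp add: G_def)
  qed
  moreover have "natural_k_iso B B (id_functor B) (comp_functor B G F) (\<lambda>p. d (u (e' p)))"
    unfolding natural_k_iso_def
  proof (intro conjI ballI)
    fix p assume "p \<in> Obj B"
    then obtain x where x: "x \<in> R" "p = e x" by auto
    then have xC: "x \<in> Obj C" using R by blast
    have fob: "fob (id_functor B) p = e x" "fob (comp_functor B G F) p = e (r x)"
      using x xC by (simp_all add: id_functor_def comp_functor_def F_def G_def)
    note d'_u = d'_hom[OF u[OF xC] x(1) r[OF xC]] and d'_w = d'_hom[OF w[OF xC] r[OF xC] x(1)]
    have du: "d (u (e' p)) \<in> hom B (e x) (e (r x))" and dw: "d (w x) \<in> hom B (e (r x)) (e x)"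
      using x homB_I u[OF xC] w[OF xC] r[OF xC] by simp_all
    then show "d (u (e' p)) \<in> hom B (fob (id_functor B) p) (fob (comp_functor B G F) p)"
      unfolding fob by simp
    show "k_iso_arrow B (d (u (e' p)))"
      using du dw
      by (rule k_iso_arrowI) (use x xC r d'_u d'_w Norm_u Norm_w wu uw in simp_all)
  next
    fix f assume "f \<in> Arr B"
    then obtain x y f' where f: "x \<in> R" "y \<in> R" "f' \<in> hom C x y" "f = d f'"
      using AR by auto
    have xy: "x \<in> Obj C" "y \<in> Obj C" using R f by auto
    show "Comp B (d (u (e' (Cod B f)))) (far (id_functor B) f)
        = Comp B (far (comp_functor B G F) f) (d (u (e' (Dom B f))))"
      using \<open>f \<in> Arr B\<close> f homD[OF f(3)] conj(4)[OF f(3)] d'_hom[OF f(3)]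
        d'_hom[OF u[OF xy(1)]] d'_hom[OF u[OF xy(2)]] d'_hom[OF conj(1)[OF f(3)]] r xy
      by (simp add: id_functor_def comp_functor_def F_def G_def)
  qed
  moreover have "natural_k_iso C C (comp_functor C F G) (id_functor C) w"
    unfolding natural_k_iso_def
  proof (intro conjI ballI)
    fix x assume x: "x \<in> Obj C"
    then show "w x \<in> hom C (fob (comp_functor C F G) x) (fob (id_functor C) x)"
      using w r by (simp add: id_functor_def comp_functor_def F_def G_def)
    show "k_iso_arrow C (w x)"
      using w[OF x] u[OF x] Norm_w[OF x] Norm_u[OF x] uw[OF x] wu[OF x] by (rule k_iso_arrowI)
  next
    fix f assume f: "f \<in> Arr C"
    then have f': "f \<in> hom C (Dom C f) (Cod C f)" by (simp add: hom_def)
    have c: "conj f \<in> hom C (r (Dom C f)) (r (Cod C f))" "r (Dom C f) \<in> R" "r (Cod C f) \<in> R"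
      using conj(1)[OF f'] hom_Obj[OF f'] r by simp_all
    then have "conj f \<in> ?AR" by (auto simp: hom_def)
    then have "far (comp_functor C F G) f = conj f"
      using f d'_hom[OF c] by (simp add: comp_functor_def F_def G_def del: full_sub_simps)
    then show "Comp C (w (Cod C f)) (far (comp_functor C F G) f) = Comp C (far (id_functor C) f) (w (Dom C f))"
      using f conj(3)[OF f'] by (simp add: id_functor_def)
  qed
  ultimately show ?thesis
    using small_B unfolding essentially_small_def equivalent_ncat_def by blast
qed

end

section \<open>Presheaf categories\<close>

lemma dual_simps [simp]:
  "Obj (dual C) = Obj C" "Arr (dual C) = Arr C" "Dom (dual C) = Cod C" "Cod (dual C) = Dom C"
  "Ident (dual C) = Ident C" "Comp (dual C) = (\<lambda>g f. Comp C f g)" "Norm (dual C) = Norm C"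
  by (simp_all add: dual_def)

lemma SetV_simps:
  "Obj SetV = {A :: ('u, 'v::comm_quantale) nset. small TYPE('u) (carr A) \<and> snorm A \<in> extensional (carr A)}"
  "Arr SetV = {f :: ('u, 'v) nmap. src f \<in> Obj SetV \<and> trg f \<in> Obj SetV \<and> act f \<in> carr (src f) \<rightarrow>\<^sub>E carr (trg f)}"
  "Dom (SetV :: (_, ('u, 'v) nmap, _) ncat) = src" "Cod (SetV :: (_, ('u, 'v) nmap, _) ncat) = trg"
  "Ident (SetV :: (_, ('u, 'v) nmap, _) ncat) = (\<lambda>A. Arrow A (restrict (\<lambda>a. a) (carr A)) A)"
  "Comp SetV = (\<lambda>(g :: ('u, 'v) nmap) f. Arrow (src f) (compose (carr (src f)) (act g) (act f)) (trg g))"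
  "Norm SetV = (\<lambda>f :: ('u, 'v) nmap. map_norm (src f) (trg f) (act f))"
  by (simp_all add: SetV_def Let_def)

lemma PSh_simps:
  "Obj (PSh C :: (('o, 'a, 'u, 'v::comm_quantale) psh, _, _) ncat) = {P. normed_functor (dual C) SetV P}"
  "Arr (PSh C) = {t :: (('o, 'a, 'u, 'v) psh, 'o \<Rightarrow> 'u \<Rightarrow> 'u) arrow.
     src t \<in> Obj (PSh C) \<and> trg t \<in> Obj (PSh C) \<and> act t \<in> carr (Nat C (src t) (trg t))}"
  "Dom (PSh C :: (('o, 'a, 'u, 'v) psh, _, _) ncat) = src"
  "Cod (PSh C :: (('o, 'a, 'u, 'v) psh, _, _) ncat) = trg"
  "Ident (PSh C :: (('o, 'a, 'u, 'v) psh, _, _) ncat) =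
     (\<lambda>P. Arrow P (\<lambda>x\<in>Obj C. restrict (\<lambda>z. z) (carr (fob P x))) P)"
  "Comp (PSh C :: (('o, 'a, 'u, 'v) psh, _, _) ncat) =
     (\<lambda>t s. Arrow (src s) (\<lambda>x\<in>Obj C. compose (carr (fob (src s) x)) (act t x) (act s x)) (trg t))"
  "Norm (PSh C :: (('o, 'a, 'u, 'v) psh, _, _) ncat) = (\<lambda>t. snorm (Nat C (src t) (trg t)) (act t))"
  by (simp_all add: PSh_def Let_def)

lemma mem_Nat_iff:
  "t \<in> carr (Nat C P Q) \<longleftrightarrow> t \<in> (\<Pi>\<^sub>E x\<in>Obj C. carr (fob P x) \<rightarrow>\<^sub>E carr (fob Q x)) \<and>
     (\<forall>f\<in>Arr C. \<forall>z\<in>carr (fob P (Cod C f)).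
        t (Dom C f) (act (far P f) z) = act (far Q f) (t (Cod C f) z))"
  by (simp add: Nat_def Let_def)

text \<open>Transformations are extensional both in the object and in the element, so no values
  outside the carriers can tell two of them apart.\<close>

lemma Nat_eqI:
  assumes "s \<in> carr (Nat C P Q)" "t \<in> carr (Nat C P Q')"
    and "\<And>x z. x \<in> Obj C \<Longrightarrow> z \<in> carr (fob P x) \<Longrightarrow> s x z = t x z"
  shows "s = t"
proof
  fix x
  show "s x = t x"
  proof (cases "x \<in> Obj C")
    case True
    then have "s x \<in> extensional (carr (fob P x))" "t x \<in> extensional (carr (fob P x))"
      using assms(1,2) by (auto simp: mem_Nat_iff PiE_def Pi_def)
    then show ?thesis
      using assms(3)[OF True] by (intro extensionalityI) auto
  next
    case False
    then show ?thesis
      using assms(1,2) by (auto simp: mem_Nat_iff PiE_def extensional_def)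
  qed
qed

lemma hom_PSh_iff:
  "t \<in> hom (PSh C) P Q \<longleftrightarrow>
     src t = P \<and> trg t = Q \<and> P \<in> Obj (PSh C) \<and> Q \<in> Obj (PSh C) \<and> act t \<in> carr (Nat C P Q)"
  for P :: "('o, 'a, 'u, 'v::comm_quantale) psh"
  by (auto simp: hom_def PSh_simps(2-4))

lemma hom_PSh_mem:
  "t \<in> hom (PSh C) P Q \<Longrightarrow> x \<in> Obj C \<Longrightarrow> z \<in> carr (fob P x) \<Longrightarrow> act t x z \<in> carr (fob Q x)"
  by (auto simp: hom_PSh_iff mem_Nat_iff)

lemma hom_PSh_natural:
  "t \<in> hom (PSh C) P Q \<Longrightarrow> f \<in> Arr C \<Longrightarrow> z \<in> carr (fob P (Cod C f)) \<Longrightarrow>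
     act t (Dom C f) (act (far P f) z) = act (far Q f) (act t (Cod C f) z)"
  by (auto simp: hom_PSh_iff mem_Nat_iff)

lemma hom_PSh_eqI:
  assumes "s \<in> hom (PSh C) P Q" "t \<in> hom (PSh C) P Q"
    and "\<And>x z. x \<in> Obj C \<Longrightarrow> z \<in> carr (fob P x) \<Longrightarrow> act s x z = act t x z"
  shows "s = t"
  using assms Nat_eqI[of "act s" C P Q "act t" Q] by (intro arrow.expand) (auto simp: hom_PSh_iff)

lemma le_Norm_PSh_iff:
  assumes "t \<in> hom (PSh C) P Q"
  shows "v \<le> Norm (PSh C) t \<longleftrightarrow>
    (\<forall>x\<in>Obj C. \<forall>z\<in>carr (fob P x). v * snorm (fob P x) z \<le> snorm (fob Q x) (act t x z))"
  using assms
  by (simp add: hom_PSh_iff mem_Nat_iff PSh_simps(7) Nat_def Let_def le_INF_iff le_map_norm_iff)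

lemma act_Comp_PSh:
  "s \<in> hom (PSh C) P Q \<Longrightarrow> x \<in> Obj C \<Longrightarrow> z \<in> carr (fob P x) \<Longrightarrow>
     act (Comp (PSh C) t s) x z = act t x (act s x z)"
  by (simp add: PSh_simps hom_PSh_iff compose_eq)

lemma src_Comp_PSh: "src (Comp (PSh C) t s) = src s"
  by (simp add: PSh_simps(6))

text \<open>A composite takes its target from the left factor merely as a label, so relabelling the
  target commutes with precomposition. This carries cocone equations over to subpresheaves.\<close>

lemma Comp_Arrow_PSh:
  "Comp (PSh C) (Arrow P (act t) Q) s = Arrow (src s) (act (Comp (PSh C) t s)) Q"
  by (simp add: PSh_simps(6))

lemma act_Ident_PSh:
  "x \<in> Obj C \<Longrightarrow> z \<in> carr (fob P x) \<Longrightarrow> act (Ident (PSh C) P) x z = z"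
  by (simp add: PSh_simps)

text \<open>The conditions on a contravariant normed functor into normed sets are unwound here once,
  into statements about elements; \<open>Obj_PSh_I\<close> is the way back.\<close>

lemma Obj_PSh_D:
  fixes P :: "('o, 'a, 'u, 'v::comm_quantale) psh"
  assumes "P \<in> Obj (PSh C)"
  shows "x \<in> Obj C \<Longrightarrow> small TYPE('u) (carr (fob P x))"
    and "x \<in> Obj C \<Longrightarrow> snorm (fob P x) \<in> extensional (carr (fob P x))"
    and "f \<in> Arr C \<Longrightarrow> src (far P f) = fob P (Cod C f)"
    and "f \<in> Arr C \<Longrightarrow> trg (far P f) = fob P (Dom C f)"
    and "f \<in> Arr C \<Longrightarrow> act (far P f) \<in> carr (fob P (Cod C f)) \<rightarrow>\<^sub>E carr (fob P (Dom C f))"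
    and "fob P \<in> extensional (Obj C)"
    and "far P \<in> extensional (Arr C)"
    and "x \<in> Obj C \<Longrightarrow> z \<in> carr (fob P x) \<Longrightarrow> act (far P (Ident C x)) z = z"
    and "f \<in> Arr C \<Longrightarrow> g \<in> Arr C \<Longrightarrow> Cod C f = Dom C g \<Longrightarrow> z \<in> carr (fob P (Cod C g)) \<Longrightarrow>
      act (far P (Comp C g f)) z = act (far P f) (act (far P g) z)"
    and "f \<in> Arr C \<Longrightarrow> z \<in> carr (fob P (Cod C f)) \<Longrightarrow>
      Norm C f * snorm (fob P (Cod C f)) z \<le> snorm (fob P (Dom C f)) (act (far P f) z)"
proof -
  have N: "normed_functor (dual C) SetV P"
    using assms by (simp add: PSh_simps)
  then show "x \<in> Obj C \<Longrightarrow> small TYPE('u) (carr (fob P x))"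
    "x \<in> Obj C \<Longrightarrow> snorm (fob P x) \<in> extensional (carr (fob P x))"
    by (auto simp: normed_functor_def SetV_simps PiE_def Pi_def)
  show src: "f \<in> Arr C \<Longrightarrow> src (far P f) = fob P (Cod C f)"
    and trg: "f \<in> Arr C \<Longrightarrow> trg (far P f) = fob P (Dom C f)" for f
    using N by (auto simp: normed_functor_def SetV_simps(3,4))
  show "act (far P f) \<in> carr (fob P (Cod C f)) \<rightarrow>\<^sub>E carr (fob P (Dom C f))" if "f \<in> Arr C"
  proof -
    have "far P f \<in> Arr SetV"
      using N that by (auto simp: normed_functor_def)
    then show ?thesis
      by (simp add: SetV_simps(2) src trg that)
  qed
  show "fob P \<in> extensional (Obj C)" "far P \<in> extensional (Arr C)"
    using N by (auto simp: normed_functor_def PiE_def)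
  show "x \<in> Obj C \<Longrightarrow> z \<in> carr (fob P x) \<Longrightarrow> act (far P (Ident C x)) z = z"
    using N by (simp add: normed_functor_def SetV_simps(5))
  show "f \<in> Arr C \<Longrightarrow> g \<in> Arr C \<Longrightarrow> Cod C f = Dom C g \<Longrightarrow> z \<in> carr (fob P (Cod C g)) \<Longrightarrow>
      act (far P (Comp C g f)) z = act (far P f) (act (far P g) z)"
    using N by (simp add: normed_functor_def SetV_simps(6) src compose_eq)
  show "f \<in> Arr C \<Longrightarrow> z \<in> carr (fob P (Cod C f)) \<Longrightarrow>
      Norm C f * snorm (fob P (Cod C f)) z \<le> snorm (fob P (Dom C f)) (act (far P f) z)"
    using N src trg by (simp add: normed_functor_def SetV_simps(7) le_map_norm_iff)
qed

lemma Obj_PSh_act_mem: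
  "P \<in> Obj (PSh C) \<Longrightarrow> f \<in> Arr C \<Longrightarrow> z \<in> carr (fob P (Cod C f)) \<Longrightarrow> act (far P f) z \<in> carr (fob P (Dom C f))"
  using Obj_PSh_D(5) by (fastforce simp: PiE_def)

section \<open>Construction of presheaves, of their morphisms and of their category\<close>

context normed_category
begin

lemma Comp_Arr:
  assumes "f \<in> Arr C" "g \<in> Arr C" "Cod C f = Dom C g"
  shows "Comp C g f \<in> Arr C" "Dom C (Comp C g f) = Dom C f" "Cod C (Comp C g f) = Cod C g"
  using Comp_hom[of f "Dom C f" "Cod C f" g "Cod C g"] assms by (auto simp: hom_def)

lemma Ident_Arr:
  assumes "x \<in> Obj C"
  shows "Ident C x \<in> Arr C" "Dom C (Ident C x) = x" "Cod C (Ident C x) = x"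
  using Ident_hom[OF assms] by (auto simp: hom_def)

lemma Obj_PSh_I:
  fixes P :: "('o, 'a, 'u, 'v) psh"
  assumes small: "\<And>x. x \<in> Obj C \<Longrightarrow> small TYPE('u) (carr (fob P x))"
    and ext: "\<And>x. x \<in> Obj C \<Longrightarrow> snorm (fob P x) \<in> extensional (carr (fob P x))"
    and src: "\<And>f. f \<in> Arr C \<Longrightarrow> src (far P f) = fob P (Cod C f)"
    and trg: "\<And>f. f \<in> Arr C \<Longrightarrow> trg (far P f) = fob P (Dom C f)"
    and act: "\<And>f. f \<in> Arr C \<Longrightarrow> act (far P f) \<in> carr (fob P (Cod C f)) \<rightarrow>\<^sub>E carr (fob P (Dom C f))"
    and fob: "fob P \<in> extensional (Obj C)"
    and far: "far P \<in> extensional (Arr C)"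
    and Ident: "\<And>x z. x \<in> Obj C \<Longrightarrow> z \<in> carr (fob P x) \<Longrightarrow> act (far P (Ident C x)) z = z"
    and Comp: "\<And>f g z. f \<in> Arr C \<Longrightarrow> g \<in> Arr C \<Longrightarrow> Cod C f = Dom C g \<Longrightarrow> z \<in> carr (fob P (Cod C g)) \<Longrightarrow>
      act (far P (Comp C g f)) z = act (far P f) (act (far P g) z)"
    and Norm: "\<And>f z. f \<in> Arr C \<Longrightarrow> z \<in> carr (fob P (Cod C f)) \<Longrightarrow>
      Norm C f * snorm (fob P (Cod C f)) z \<le> snorm (fob P (Dom C f)) (act (far P f) z)"
  shows "P \<in> Obj (PSh C)"
  unfolding PSh_simps mem_Collect_eq normed_functor_def dual_simps
proof (intro conjI ballI impI)
  have Ob: "x \<in> Obj C \<Longrightarrow> fob P x \<in> Obj SetV" for x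
    using small ext by (simp add: SetV_simps)
  then show "fob P \<in> Obj C \<rightarrow>\<^sub>E Obj SetV"
    using fob by (auto simp: PiE_def)
  show "far P \<in> Arr C \<rightarrow>\<^sub>E Arr SetV"
    using far Ob act Dom_Obj Cod_Obj by (auto simp: PiE_def SetV_simps(2) src trg)
  fix f assume f: "f \<in> Arr C"
  then show "Dom SetV (far P f) = fob P (Cod C f)" "Cod SetV (far P f) = fob P (Dom C f)"
    by (simp_all add: SetV_simps src trg)
  show "Norm C f \<le> Norm SetV (far P f)"
    using f by (simp add: SetV_simps le_map_norm_iff src trg Norm)
next
  fix x assume x: "x \<in> Obj C"
  \<comment> \<open>Identities and composites in \<open>SetV\<close> are extensional maps, so the
    elementwise laws give equality of arrows.\<close>
  have "act (far P (Ident C x)) = restrict (\<lambda>a. a) (carr (fob P x))"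
    using act[OF Ident_Arr(1)[OF x]] Ident[OF x] Ident_Arr[OF x]
    by (intro extensionalityI[of _ "carr (fob P x)"]) (auto simp: PiE_def)
  then show "far P (Ident C x) = Ident SetV (fob P x)"
    using Ident_Arr[OF x] by (intro arrow.expand) (simp add: SetV_simps src trg)
next
  fix g f assume fg: "g \<in> Arr C" "f \<in> Arr C" "Dom C g = Cod C f"
  note c = Comp_Arr[OF fg(2,1) fg(3)[symmetric]]
  have "act (far P (Comp C g f)) = compose (carr (fob P (Cod C g))) (act (far P f)) (act (far P g))"
    using act[OF c(1)] Comp[OF fg(2,1) fg(3)[symmetric]] c
    by (intro extensionalityI[of _ "carr (fob P (Cod C g))"]) (auto simp: PiE_def compose_eq)
  then show "far P (Comp C g f) = Comp SetV (far P f) (far P g)"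
    using c fg by (intro arrow.expand) (simp add: SetV_simps src trg)
qed

text \<open>All natural transformations are morphisms, whatever their norm. The restrictions turn
  the formula \<open>t\<close> into an extensional family.\<close>

lemma hom_PSh_I:
  assumes "P \<in> Obj (PSh C)" "Q \<in> Obj (PSh C)"
    and "\<And>x z. x \<in> Obj C \<Longrightarrow> z \<in> carr (fob P x) \<Longrightarrow> t x z \<in> carr (fob Q x)"
    and "\<And>f z. f \<in> Arr C \<Longrightarrow> z \<in> carr (fob P (Cod C f)) \<Longrightarrow>
      t (Dom C f) (act (far P f) z) = act (far Q f) (t (Cod C f) z)"
  shows "Arrow P (\<lambda>x\<in>Obj C. restrict (t x) (carr (fob P x))) Q \<in> hom (PSh C) P Q"
  using assms Dom_Obj Cod_Obj Obj_PSh_act_mem[OF assms(1)]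
  by (auto simp: hom_PSh_iff mem_Nat_iff)

lemma normed_category_PSh: "normed_category (PSh C :: (('o, 'a, 'u, 'v) psh, _, _) ncat)"
proof unfold_locales
  fix f assume "f \<in> Arr (PSh C :: (('o, 'a, 'u, 'v) psh, _, _) ncat)"
  then show "Dom (PSh C) f \<in> Obj (PSh C)" "Cod (PSh C) f \<in> Obj (PSh C)"
    by (auto simp: PSh_simps(2-4))
next
  fix P assume P: "P \<in> Obj (PSh C :: (('o, 'a, 'u, 'v) psh, _, _) ncat)"
  show I: "Ident (PSh C) P \<in> hom (PSh C) P P"
    using hom_PSh_I[OF P P, of "\<lambda>x z. z"] by (simp add: PSh_simps)
  show "1 \<le> Norm (PSh C) (Ident (PSh C) P)"
    by (simp add: le_Norm_PSh_iff[OF I] act_Ident_PSh)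
next
  have C: "Comp (PSh C) t s \<in> hom (PSh C) P R"
    if s: "s \<in> hom (PSh C) P Q" and t: "t \<in> hom (PSh C) Q R" for s t and P Q R :: "('o, 'a, 'u, 'v) psh"
  proof -
    have "Arrow P (\<lambda>x\<in>Obj C. restrict (\<lambda>z. act t x (act s x z)) (carr (fob P x))) R \<in> hom (PSh C) P R"
      using s t
      by (intro hom_PSh_I) (auto simp: hom_PSh_natural hom_PSh_mem Cod_Obj, auto simp: hom_PSh_iff)
    then show ?thesis
      using s t by (simp add: PSh_simps(6) compose_def hom_PSh_iff)
  qed
  fix s and P Q :: "('o, 'a, 'u, 'v) psh" assume s: "s \<in> hom (PSh C) P Q"
  then have I: "Ident (PSh C) P \<in> hom (PSh C) P P" "Ident (PSh C) Q \<in> hom (PSh C) Q Q"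
    using hom_PSh_I[of P P "\<lambda>x z. z"] hom_PSh_I[of Q Q "\<lambda>x z. z"] by (simp_all add: PSh_simps hom_PSh_iff)
  show "Comp (PSh C) s (Ident (PSh C) P) = s"
    using C[OF I(1) s] s by (rule hom_PSh_eqI) (simp add: act_Comp_PSh[OF I(1)] act_Ident_PSh)
  show "Comp (PSh C) (Ident (PSh C) Q) s = s"
    using C[OF s I(2)] s by (rule hom_PSh_eqI) (simp add: act_Comp_PSh[OF s] act_Ident_PSh hom_PSh_mem[OF s])
  fix t R assume t: "t \<in> hom (PSh C) Q R"
  show "Comp (PSh C) t s \<in> hom (PSh C) P R"
    using s t by (rule C)
  show "Norm (PSh C) s * Norm (PSh C) t \<le> Norm (PSh C) (Comp (PSh C) t s)"
    unfolding le_Norm_PSh_iff[OF C[OF s t]]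
  proof (intro ballI)
    fix x z assume x: "x \<in> Obj C" and z: "z \<in> carr (fob P x)"
    \<comment> \<open>By commutativity of the tensor the norm of \<open>s\<close> is applied to the
      element first and that of \<open>t\<close> to its image.\<close>
    have "Norm (PSh C) s * Norm (PSh C) t * snorm (fob P x) z
        = Norm (PSh C) t * (Norm (PSh C) s * snorm (fob P x) z)"
      by (simp add: ac_simps)
    also have "\<dots> \<le> Norm (PSh C) t * snorm (fob Q x) (act s x z)"
      using le_Norm_PSh_iff[OF s] x z by (intro quantale_mult_mono) auto
    also have "\<dots> \<le> snorm (fob R x) (act t x (act s x z))"
      using le_Norm_PSh_iff[OF t] x hom_PSh_mem[OF s x z] by blast
    finally show "Norm (PSh C) s * Norm (PSh C) t * snorm (fob P x) z
        \<le> snorm (fob R x) (act (Comp (PSh C) t s) x z)"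
      using x z by (simp add: act_Comp_PSh[OF s])
  qed
  fix w T assume w: "w \<in> hom (PSh C) R T"
  show "Comp (PSh C) w (Comp (PSh C) t s) = Comp (PSh C) (Comp (PSh C) w t) s"
    using C[OF C[OF s t] w] C[OF s C[OF t w]]
    by (rule hom_PSh_eqI)
      (simp add: act_Comp_PSh[OF s] act_Comp_PSh[OF t] act_Comp_PSh[OF C[OF s t]] hom_PSh_mem[OF s])
qed

section \<open>Representable presheaves\<close>

lemma fob_representable: "x \<in> Obj C \<Longrightarrow> fob (representable C a) x = homset C x a"
  by (simp add: representable_def hom_presheaf_def id_functor_def)

lemma far_representable:
  "f \<in> Arr C \<Longrightarrow> far (representable C a) f =
     Arrow (homset C (Cod C f) a) (\<lambda>g\<in>hom C (Cod C f) a. Comp C g f) (homset C (Dom C f) a)"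
  by (simp add: representable_def hom_presheaf_def id_functor_def Dom_Obj Cod_Obj)

text \<open>The elements of a representable are arrows, so here smallness is measured by the type of
  arrows. The norm condition on its action is the norm inequality for composition in
  \<open>C\<close>.\<close>

lemma representable_in_PSh:
  assumes "\<And>x. small TYPE('a) (hom C x a)"
  shows "representable C a \<in> Obj (PSh C)"
proof (rule Obj_PSh_I)
  show "fob (representable C a) \<in> extensional (Obj C)" "far (representable C a) \<in> extensional (Arr C)"
    by (simp_all add: representable_def hom_presheaf_def)
  fix x assume x: "x \<in> Obj C"
  then show "small TYPE('a) (carr (fob (representable C a) x))"
    "snorm (fob (representable C a) x) \<in> extensional (carr (fob (representable C a) x))"
    using assms by (simp_all add: fob_representable homset_def)
  fix z assume "z \<in> carr (fob (representable C a) x)"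
  then show "act (far (representable C a) (Ident C x)) z = z"
    using x by (simp add: fob_representable far_representable homset_def Ident_Arr Comp_Ident)
next
  fix f assume f: "f \<in> Arr C"
  then have f': "f \<in> hom C (Dom C f) (Cod C f)" by (simp add: hom_def)
  show "src (far (representable C a) f) = fob (representable C a) (Cod C f)"
    "trg (far (representable C a) f) = fob (representable C a) (Dom C f)"
    using f by (simp_all add: fob_representable far_representable Dom_Obj Cod_Obj)
  show "act (far (representable C a) f) \<in> carr (fob (representable C a) (Cod C f)) \<rightarrow>\<^sub>E
      carr (fob (representable C a) (Dom C f))"
    using f Comp_hom[OF f'] by (simp add: fob_representable far_representable Dom_Obj Cod_Obj homset_def)
  show "Norm C f * snorm (fob (representable C a) (Cod C f)) z \<le>
      snorm (fob (representable C a) (Dom C f)) (act (far (representable C a) f) z)"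
    if "z \<in> carr (fob (representable C a) (Cod C f))" for z
    using that f Comp_hom[OF f'] Norm_Comp[OF f']
    by (simp add: fob_representable far_representable Dom_Obj Cod_Obj homset_def)
  fix g z assume g: "g \<in> Arr C" and eq: "Cod C f = Dom C g"
    and z: "z \<in> carr (fob (representable C a) (Cod C g))"
  then have g': "g \<in> hom C (Cod C f) (Cod C g)" by (simp add: hom_def)
  show "act (far (representable C a) (Comp C g f)) z =
      act (far (representable C a) f) (act (far (representable C a) g) z)"
    using f g z Comp_hom[OF g'] Comp_assoc[OF f' g'] Comp_Arr[OF f g eq]
    by (simp add: fob_representable far_representable Cod_Obj homset_def eq)
qed

end

section \<open>Subpresheaves and covers\<close>

text \<open>Defined for every family \<open>D\<close>; it is a presheaf when \<open>D\<close> is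
  closed under the action of \<open>Q\<close>, as the locale \<open>subpresheaf\<close> demands.
  Norms are inherited from \<open>Q\<close>.\<close>

definition sub_psh :: "('o, 'a, 'v::comm_quantale) ncat \<Rightarrow> ('o, 'a, 'u, 'v) psh \<Rightarrow> ('o \<Rightarrow> 'u set) \<Rightarrow> ('o, 'a, 'u, 'v) psh" where
  "sub_psh C Q D =
    (let S = \<lambda>x. NSet (D x) (restrict (snorm (fob Q x)) (D x)) in
     \<lparr>fob = restrict S (Obj C),
      far = (\<lambda>f\<in>Arr C. Arrow (S (Cod C f)) (restrict (act (far Q f)) (D (Cod C f))) (S (Dom C f)))\<rparr>)"

definition sub_incl :: "('o, 'a, 'v::comm_quantale) ncat \<Rightarrow> ('o, 'a, 'u, 'v) psh \<Rightarrow> ('o \<Rightarrow> 'u set) \<Rightarrow>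
    (('o, 'a, 'u, 'v) psh, 'o \<Rightarrow> 'u \<Rightarrow> 'u) arrow" where
  "sub_incl C Q D = Arrow (sub_psh C Q D) (\<lambda>x\<in>Obj C. restrict (\<lambda>z. z) (carr (fob (sub_psh C Q D) x))) Q"

locale subpresheaf = normed_category C
  for C :: "('o, 'a, 'v::comm_quantale) ncat" +
  fixes Q :: "('o, 'a, 'u, 'v) psh" and D :: "'o \<Rightarrow> 'u set"
  assumes Q: "Q \<in> Obj (PSh C)"
    and D_subset: "x \<in> Obj C \<Longrightarrow> D x \<subseteq> carr (fob Q x)"
    and D_closed: "f \<in> Arr C \<Longrightarrow> z \<in> D (Cod C f) \<Longrightarrow> act (far Q f) z \<in> D (Dom C f)"
begin

lemma fob_sub_psh: "x \<in> Obj C \<Longrightarrow> fob (sub_psh C Q D) x = NSet (D x) (restrict (snorm (fob Q x)) (D x))"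
  by (simp add: sub_psh_def)

lemma far_sub_psh:
  "f \<in> Arr C \<Longrightarrow> far (sub_psh C Q D) f =
     Arrow (fob (sub_psh C Q D) (Cod C f)) (restrict (act (far Q f)) (D (Cod C f))) (fob (sub_psh C Q D) (Dom C f))"
  by (simp add: sub_psh_def Let_def Dom_Obj Cod_Obj)

lemma sub_psh_Obj: "sub_psh C Q D \<in> Obj (PSh C)"
proof (rule Obj_PSh_I)
  show "fob (sub_psh C Q D) \<in> extensional (Obj C)" "far (sub_psh C Q D) \<in> extensional (Arr C)"
    by (simp_all add: sub_psh_def Let_def)
  fix x assume x: "x \<in> Obj C"
  then show "small TYPE('u) (carr (fob (sub_psh C Q D) x))"
    using small_subset[OF Obj_PSh_D(1)[OF Q x] D_subset[OF x]] by (simp add: fob_sub_psh)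
  show "snorm (fob (sub_psh C Q D) x) \<in> extensional (carr (fob (sub_psh C Q D) x))"
    using x by (simp add: fob_sub_psh)
  fix z assume "z \<in> carr (fob (sub_psh C Q D) x)"
  then show "act (far (sub_psh C Q D) (Ident C x)) z = z"
    using x Obj_PSh_D(8)[OF Q x] D_subset[OF x] by (auto simp: fob_sub_psh far_sub_psh Ident_Arr)
next
  fix f assume f: "f \<in> Arr C"
  show "src (far (sub_psh C Q D) f) = fob (sub_psh C Q D) (Cod C f)"
    "trg (far (sub_psh C Q D) f) = fob (sub_psh C Q D) (Dom C f)"
    using f by (simp_all add: far_sub_psh)
  show "act (far (sub_psh C Q D) f) \<in> carr (fob (sub_psh C Q D) (Cod C f)) \<rightarrow>\<^sub>E carr (fob (sub_psh C Q D) (Dom C f))"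
    using f D_closed by (auto simp: far_sub_psh fob_sub_psh Dom_Obj Cod_Obj)
  show "Norm C f * snorm (fob (sub_psh C Q D) (Cod C f)) z \<le>
      snorm (fob (sub_psh C Q D) (Dom C f)) (act (far (sub_psh C Q D) f) z)"
    if "z \<in> carr (fob (sub_psh C Q D) (Cod C f))" for z
    using that f D_closed[OF f] Obj_PSh_D(10)[OF Q f] D_subset[OF Cod_Obj[OF f]]
    by (auto simp: far_sub_psh fob_sub_psh Dom_Obj Cod_Obj)
  fix g z assume g: "g \<in> Arr C" and eq: "Cod C f = Dom C g"
    and z: "z \<in> carr (fob (sub_psh C Q D) (Cod C g))"
  then show "act (far (sub_psh C Q D) (Comp C g f)) z =
      act (far (sub_psh C Q D) f) (act (far (sub_psh C Q D) g) z)"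
    using f Obj_PSh_D(9)[OF Q f g eq] Comp_Arr[OF f g eq] D_subset[OF Cod_Obj[OF g]] D_closed[OF g]
    by (auto simp: far_sub_psh fob_sub_psh Cod_Obj)
qed

lemma sub_incl_hom: "sub_incl C Q D \<in> hom (PSh C) (sub_psh C Q D) Q"
  unfolding sub_incl_def
  using sub_psh_Obj Q D_subset
  by (intro hom_PSh_I) (auto simp: fob_sub_psh far_sub_psh Cod_Obj)

lemma act_sub_incl: "x \<in> Obj C \<Longrightarrow> z \<in> D x \<Longrightarrow> act (sub_incl C Q D) x z = z"
  by (simp add: sub_incl_def fob_sub_psh)

text \<open>Arrows carry their codomain, so factoring through the subpresheaf keeps the underlying
  transformation and changes its target.\<close>

lemma corestrict:
  assumes t: "t \<in> hom (PSh C) P Q"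
    and image: "\<And>x z. x \<in> Obj C \<Longrightarrow> z \<in> carr (fob P x) \<Longrightarrow> act t x z \<in> D x"
  shows "Arrow P (act t) (sub_psh C Q D) \<in> hom (PSh C) P (sub_psh C Q D)"
    and "Comp (PSh C) (sub_incl C Q D) (Arrow P (act t) (sub_psh C Q D)) = t"
proof -
  have P: "P \<in> Obj (PSh C)" using t by (simp add: hom_PSh_iff)
  have "act t x \<in> carr (fob P x) \<rightarrow>\<^sub>E D x" if "x \<in> Obj C" for x
  proof -
    have "act t x \<in> carr (fob P x) \<rightarrow>\<^sub>E carr (fob Q x)"
      using t that by (auto simp: hom_PSh_iff mem_Nat_iff)
    then show ?thesis
      using image that by (auto simp: PiE_def)
  qed
  moreover have "act t \<in> extensional (Obj C)"
    using t by (simp add: hom_PSh_iff mem_Nat_iff PiE_def)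
  ultimately show h: "Arrow P (act t) (sub_psh C Q D) \<in> hom (PSh C) P (sub_psh C Q D)"
    using P sub_psh_Obj image hom_PSh_natural[OF t]
    by (auto simp: hom_PSh_iff mem_Nat_iff fob_sub_psh far_sub_psh Cod_Obj PiE_def)
  interpret PSh: normed_category "PSh C :: (('o, 'a, 'u, 'v) psh, _, _) ncat"
    by (rule normed_category_PSh)
  show "Comp (PSh C) (sub_incl C Q D) (Arrow P (act t) (sub_psh C Q D)) = t"
    using PSh.Comp_hom[OF h sub_incl_hom] t
    by (rule hom_PSh_eqI) (simp add: act_Comp_PSh[OF h] act_sub_incl image)
qed

text \<open>If \<open>h\<close> is a section of the inclusion, every element \<open>z\<close> is the
  inclusion of its image under \<open>h\<close>, which lies in \<open>D\<close>. Both covering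
  results end with this observation.\<close>

lemma retract_cover:
  assumes h: "h \<in> hom (PSh C) Q (sub_psh C Q D)"
    and id: "Comp (PSh C) (sub_incl C Q D) h = Ident (PSh C) Q"
    and x: "x \<in> Obj C"
  shows "carr (fob Q x) \<subseteq> D x"
proof
  fix z assume z: "z \<in> carr (fob Q x)"
  have "act h x z \<in> D x"
    using hom_PSh_mem[OF h x z] x by (simp add: fob_sub_psh)
  moreover have "act (sub_incl C Q D) x (act h x z) = z"
    using act_Comp_PSh[OF h x z, of "sub_incl C Q D"] x z by (simp add: id act_Ident_PSh)
  ultimately show "z \<in> D x"
    using x by (simp add: act_sub_incl)
qed

end

section \<open>Covers obtained from universal properties\<close>

context normed_category
begin

text \<open>By naturality, acting on the image of \<open>w\<close> gives the image of the action on
  \<open>w\<close>, so the elements reached by the \<open>t n\<close> are closed under the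
  action.\<close>

lemma subpresheaf_images:
  assumes Q: "Q \<in> Obj (PSh C)" and t: "\<And>n. t n \<in> hom (PSh C) (P n) Q"
  shows "subpresheaf C Q (\<lambda>x. \<Union>n. act (t n) x ` carr (fob (P n) x))"
proof unfold_locales
  show "(\<Union>n. act (t n) x ` carr (fob (P n) x)) \<subseteq> carr (fob Q x)" if "x \<in> Obj C" for x
    using hom_PSh_mem[OF t that] by blast
  fix f z assume f: "f \<in> Arr C" and "z \<in> (\<Union>n. act (t n) (Cod C f) ` carr (fob (P n) (Cod C f)))"
  then obtain n w where w: "w \<in> carr (fob (P n) (Cod C f))" "z = act (t n) (Cod C f) w"
    by blast
  have "act (far Q f) z = act (t n) (Dom C f) (act (far (P n) f) w)"
    using hom_PSh_natural[OF t f w(1)] w(2) by simp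
  moreover have "act (far (P n) f) w \<in> carr (fob (P n) (Dom C f))"
    using t[of n] Obj_PSh_act_mem[OF _ f w(1)] by (simp add: hom_PSh_iff)
  ultimately show "act (far Q f) z \<in> (\<Union>n. act (t n) (Dom C f) ` carr (fob (P n) (Dom C f)))"
    by blast
qed (rule Q)

text \<open>The cocone factors through the subpresheaf of elements it reaches. The induced arrow
  from \<open>Q\<close>, followed by the inclusion, agrees with the identity on the cocone, so
  uniqueness makes it the identity and the subpresheaf is all of \<open>Q\<close>.\<close>

lemma colimit_cocone_cover:
  fixes P :: "nat \<Rightarrow> ('o, 'a, 'u, 'v) psh"
  assumes colim: "colimit_cocone (PSh C) P s Q \<gamma>" and x: "x \<in> Obj C"
  shows "carr (fob Q x) \<subseteq> (\<Union>n. act (\<gamma> n) x ` carr (fob (P n) x))"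
proof -
  have cc: "cocone (PSh C) P s Q \<gamma>"
    and ex1: "cocone (PSh C) P s d \<delta> \<Longrightarrow> \<exists>!h. h \<in> hom (PSh C) Q d \<and> (\<forall>n. Comp (PSh C) h (\<gamma> n) = \<delta> n)" for d \<delta>
    using colim by (simp_all add: colimit_cocone_def)
  then have Q: "Q \<in> Obj (PSh C)" and \<gamma>: "\<And>n. \<gamma> n \<in> hom (PSh C) (P n) Q"
    by (simp_all add: cocone_def)
  let ?D = "\<lambda>x. \<Union>n. act (\<gamma> n) x ` carr (fob (P n) x)"
  interpret S: subpresheaf C Q ?D
    using Q \<gamma> by (rule subpresheaf_images)
  interpret PSh: normed_category "PSh C :: (('o, 'a, 'u, 'v) psh, _, _) ncat"
    by (rule normed_category_PSh)
  let ?i = "sub_incl C Q ?D" and ?S = "sub_psh C Q ?D"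
  let ?\<delta> = "\<lambda>n. Arrow (P n) (act (\<gamma> n)) ?S"
  have \<delta>: "?\<delta> n \<in> hom (PSh C) (P n) ?S" "Comp (PSh C) ?i (?\<delta> n) = \<gamma> n" for n
    using S.corestrict[OF \<gamma>] by blast+
  have "Comp (PSh C) (?\<delta> n) (s m n) = ?\<delta> m" if "m \<le> n" for m n
  proof -
    have eq: "Comp (PSh C) (\<gamma> n) (s m n) = \<gamma> m"
      using cc that by (simp add: cocone_def)
    \<comment> \<open>The source of \<open>s m n\<close> is read off from the cocone equation, since
      a composite has the source of its right factor.\<close>
    have "src (s m n) = P m"
      using \<gamma>[of m] src_Comp_PSh[of C "\<gamma> n" "s m n"] by (simp add: eq hom_PSh_iff)
    then show ?thesis
      by (simp add: Comp_Arrow_PSh eq)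
  qed
  then have "cocone (PSh C) P s ?S ?\<delta>"
    using \<delta>(1) S.sub_psh_Obj by (simp add: cocone_def)
  then obtain h where h: "h \<in> hom (PSh C) Q ?S" "\<And>n. Comp (PSh C) h (\<gamma> n) = ?\<delta> n"
    using ex1 by blast
  have "Comp (PSh C) ?i h \<in> hom (PSh C) Q Q"
    using h(1) S.sub_incl_hom by (rule PSh.Comp_hom)
  moreover have "Comp (PSh C) (Comp (PSh C) ?i h) (\<gamma> n) = \<gamma> n" for n
    using PSh.Comp_assoc[OF \<gamma> h(1) S.sub_incl_hom, of n] h(2) \<delta>(2) by simp
  ultimately have "Comp (PSh C) ?i h = Ident (PSh C) Q"
    using ex1[OF cc] PSh.Ident_hom[OF Q] PSh.Ident_Comp[OF \<gamma>] by blast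
  then show ?thesis
    using S.retract_cover[OF h(1) _ x] by simp
qed

end

text \<open>Countably many elements generate a weight. The colimit cocone of representables covers
  \<open>P\<close>, and by Yoneda each \<gamma> n is determined by the image \<open>w n\<close> of
  the identity of \<open>a n\<close>: an arrow \<open>f\<close> is itself the action of
  \<open>f\<close> on that identity, so its image is the action of \<open>f\<close> on
  \<open>w n\<close>.\<close>

lemma Phi_weights_generated:
  fixes A :: "('u, 'u, 'v::comm_quantale) ncat"
  assumes A: "normed_category A" and P: "P \<in> Phi_weights A"
  obtains a :: "nat \<Rightarrow> 'u" and w where "P \<in> Obj (PSh A)" "\<And>n. a n \<in> Obj A" "\<And>n. w n \<in> carr (fob P (a n))"
    "\<And>x z. x \<in> Obj A \<Longrightarrow> z \<in> carr (fob P x) \<Longrightarrow> \<exists>n. \<exists>f\<in>hom A x (a n). z = act (far P f) (w n)"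
proof -
  interpret A: normed_category A by (rule A)
  obtain x s \<gamma> where repr: "\<forall>n. \<exists>a\<in>Obj A. x n = representable A a"
    and colim: "colimit_cocone (PSh A) x s P \<gamma>"
    using P by (auto simp: Phi_weights_def normed_colimit_def)
  obtain a where a: "\<And>n. a n \<in> Obj A" "\<And>n. x n = representable A (a n)"
    using repr by metis
  have \<gamma>: "\<gamma> n \<in> hom (PSh A) (representable A (a n)) P" for n
    using colim a(2) by (simp add: colimit_cocone_def cocone_def)
  let ?w = "\<lambda>n. act (\<gamma> n) (a n) (Ident A (a n))"
  have id: "Ident A (a n) \<in> carr (fob (representable A (a n)) (a n))" for n
    using A.Ident_hom[OF a(1)] by (simp add: A.fob_representable a(1) homset_def)
  show thesis
  proof
    show "P \<in> Obj (PSh A)"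
      using \<gamma> by (simp add: hom_PSh_iff)
    show "a n \<in> Obj A" "?w n \<in> carr (fob P (a n))" for n
      using a(1) hom_PSh_mem[OF \<gamma> a(1) id] by simp_all
    fix y z assume y: "y \<in> Obj A" and z: "z \<in> carr (fob P y)"
    then obtain n f where "f \<in> carr (fob (x n) y)" and zf: "z = act (\<gamma> n) y f"
      using A.colimit_cocone_cover[OF colim y] by blast
    then have f: "f \<in> hom A y (a n)"
      using y by (simp add: a(2) A.fob_representable homset_def)
    then have "act (far (representable A (a n)) f) (Ident A (a n)) = f"
      using homD[OF f] A.Ident_hom[OF a(1)[of n]] A.Ident_Comp[OF f] by (simp add: A.far_representable)
    then have "z = act (far P f) (?w n)"
      using hom_PSh_natural[OF \<gamma>[of n], of f "Ident A (a n)"] id[of n] homD[OF f] zf by simp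
    with f show "\<exists>n. \<exists>f\<in>hom A y (a n). z = act (far P f) (?w n)"
      by blast
  qed
qed

context normed_category
begin

text \<open>The argument for colimit cocones, with the unit \<epsilon> of the weighted colimit in
  place of the cocone. As the \<open>w n\<close> generate \<open>P\<close>, all components of
  \<epsilon> factor through those at the \<open>w n\<close>, so the images of the countably many
  \<open>F (a n)\<close> form a subpresheaf through which the whole unit factors.\<close>

lemma weighted_colimit_cover:
  fixes A :: "('p, 'b, 'v) ncat" and c :: "('o, 'a, 'u, 'v) psh"
  assumes A: "normed_category A" and F: "normed_functor A (PSh C) F"
    and P: "P \<in> Obj (PSh A)" and colim: "weighted_colimit A (PSh C) F P c"
    and a: "\<And>n :: nat. a n \<in> Obj A" and w: "\<And>n. w n \<in> carr (fob P (a n))"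
    and gen: "\<And>x z. x \<in> Obj A \<Longrightarrow> z \<in> carr (fob P x) \<Longrightarrow> \<exists>n. \<exists>f\<in>hom A x (a n). z = act (far P f) (w n)"
  shows "\<exists>t. \<forall>x\<in>Obj C. carr (fob c x) \<subseteq> (\<Union>n. t n x ` carr (fob (fob F (a n)) x))"
proof -
  interpret A: normed_category A by (rule A)
  interpret PSh: normed_category "PSh C :: (('o, 'a, 'u, 'v) psh, _, _) ncat"
    by (rule normed_category_PSh)
  let ?Y = "PSh C :: (('o, 'a, 'u, 'v) psh, _, _) ncat"
  let ?H = "hom_presheaf A ?Y F"
  have far_F: "far F f \<in> hom ?Y (fob F (Dom A f)) (fob F (Cod A f))" if "f \<in> Arr A" for f
    using F that by (auto simp: normed_functor_def hom_def)
  have H: "x \<in> Obj A \<Longrightarrow> carr (fob (?H y) x) = hom ?Y (fob F x) y"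
    "f \<in> Arr A \<Longrightarrow> g \<in> hom ?Y (fob F (Cod A f)) y \<Longrightarrow> act (far (?H y) f) g = Comp ?Y g (far F f)" for x f g y
    by (simp_all add: hom_presheaf_def homset_def)
  have c: "c \<in> Obj ?Y"
    using colim by (simp add: weighted_colimit_def)
  obtain \<theta> where iso: "\<And>y. y \<in> Obj ?Y \<Longrightarrow> nset_iso (homset ?Y c y) (Nat A P (?H y)) (\<theta> y)"
    and nat: "\<And>g f x z. g \<in> Arr ?Y \<Longrightarrow> f \<in> hom ?Y c (Dom ?Y g) \<Longrightarrow> x \<in> Obj A \<Longrightarrow> z \<in> carr (fob P x) \<Longrightarrow>
        \<theta> (Cod ?Y g) (Comp ?Y g f) x z = Comp ?Y g (\<theta> (Dom ?Y g) f x z)"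
    using colim unfolding weighted_colimit_def by blast
  have \<theta>_mem: "\<theta> y f \<in> carr (Nat A P (?H y))" if "y \<in> Obj ?Y" "f \<in> hom ?Y c y" for y f
    using iso[OF that(1)] that(2) by (auto simp: nset_iso_def nset_map_def homset_def)
  have \<theta>_inj: "f = g" if "y \<in> Obj ?Y" "f \<in> hom ?Y c y" "g \<in> hom ?Y c y" "\<theta> y f = \<theta> y g" for y f g
    using iso[OF that(1)] that(2-) by (auto simp: nset_iso_def homset_def) metis
  have \<theta>_surj: "\<exists>f\<in>hom ?Y c y. \<theta> y f = t" if "y \<in> Obj ?Y" "t \<in> carr (Nat A P (?H y))" for y t
    using iso[OF that(1)] that(2) by (fastforce simp: nset_iso_def nset_map_def homset_def)
  note id_c = PSh.Ident_hom[OF c]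
  \<comment> \<open>The universal weighted cocone, that is, the transformation corresponding to the
    identity of \<open>c\<close>.\<close>
  define \<epsilon> where "\<epsilon> = \<theta> c (Ident ?Y c)"
  have \<epsilon>: "\<epsilon> \<in> carr (Nat A P (?H c))"
    unfolding \<epsilon>_def using c id_c by (rule \<theta>_mem)
  have \<epsilon>_hom: "\<epsilon> x z \<in> hom ?Y (fob F x) c" if "x \<in> Obj A" "z \<in> carr (fob P x)" for x z
    using \<epsilon> that by (auto simp: mem_Nat_iff H PiE_def Pi_def)
  have \<epsilon>_nat: "\<epsilon> (Dom A f) (act (far P f) z) = Comp ?Y (\<epsilon> (Cod A f) z) (far F f)"
    if "f \<in> Arr A" "z \<in> carr (fob P (Cod A f))" for f z
    using \<epsilon> that \<epsilon>_hom[OF A.Cod_Obj[OF that(1)] that(2)] by (simp add: mem_Nat_iff H)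
  let ?t = "\<lambda>n. \<epsilon> (a n) (w n)"
  let ?D = "\<lambda>x. \<Union>n. act (?t n) x ` carr (fob (fob F (a n)) x)"
  have t: "?t n \<in> hom ?Y (fob F (a n)) c" for n
    using a w by (rule \<epsilon>_hom)
  interpret S: subpresheaf C c ?D
    using c t by (rule subpresheaf_images)
  let ?i = "sub_incl C c ?D" and ?S = "sub_psh C c ?D"
  have \<epsilon>_image: "act (\<epsilon> x z) y v \<in> ?D y"
    if x: "x \<in> Obj A" and z: "z \<in> carr (fob P x)" and y: "y \<in> Obj C" and v: "v \<in> carr (fob (fob F x) y)"
    for x z y v
  proof -
    obtain n f where f: "f \<in> hom A x (a n)" "z = act (far P f) (w n)"
      using gen[OF x z] by blast
    have f': "f \<in> Arr A" "Dom A f = x" "Cod A f = a n"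
      using homD[OF f(1)] by simp_all
    \<comment> \<open>Naturality of \<epsilon> turns the action of \<open>f\<close> on a generator
      into precomposition with \<open>F f\<close>, so the component at \<open>z\<close> reaches
      nothing beyond the image of \<open>?t n\<close>.\<close>
    then have "\<epsilon> x z = Comp ?Y (?t n) (far F f)"
      using \<epsilon>_nat[of f "w n"] w f(2) by simp
    then have "act (\<epsilon> x z) y v = act (?t n) y (act (far F f) y v)"
      using act_Comp_PSh[OF far_F[OF f'(1)] y] v f' by simp
    moreover have "act (far F f) y v \<in> carr (fob (fob F (a n)) y)"
      using hom_PSh_mem[OF far_F[OF f'(1)] y] v f' by simp
    ultimately show ?thesis
      by blast
  qed
  \<comment> \<open>The unit with the target of each component relabelled to the subpresheaf; the
    restrictions put it into the extensional function spaces of \<open>Nat\<close>.\<close>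
  define \<epsilon>' where "\<epsilon>' = (\<lambda>x\<in>Obj A. \<lambda>z\<in>carr (fob P x). Arrow (fob F x) (act (\<epsilon> x z)) ?S)"
  have \<epsilon>': "\<epsilon>' x z = Arrow (fob F x) (act (\<epsilon> x z)) ?S" "\<epsilon>' x z \<in> hom ?Y (fob F x) ?S"
    "Comp ?Y ?i (\<epsilon>' x z) = \<epsilon> x z" if "x \<in> Obj A" "z \<in> carr (fob P x)" for x z
    using S.corestrict[OF \<epsilon>_hom[OF that] \<epsilon>_image[OF that]] that by (simp_all add: \<epsilon>'_def)
  have "\<epsilon>' \<in> carr (Nat A P (?H ?S))"
    unfolding mem_Nat_iff
  proof (intro conjI ballI)
    show "\<epsilon>' \<in> (\<Pi>\<^sub>E x\<in>Obj A. carr (fob P x) \<rightarrow>\<^sub>E carr (fob (?H ?S) x))"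
      using \<epsilon>'(2) by (auto simp: H PiE_def Pi_def) (simp_all add: \<epsilon>'_def)
    fix f z assume f: "f \<in> Arr A" and z: "z \<in> carr (fob P (Cod A f))"
    note Df = A.Dom_Obj[OF f] and Cf = A.Cod_Obj[OF f]
    have F_src: "src (far F f) = fob F (Dom A f)"
      using far_F[OF f] by (simp add: hom_PSh_iff)
    have "\<epsilon>' (Dom A f) (act (far P f) z) = Arrow (fob F (Dom A f)) (act (Comp ?Y (\<epsilon> (Cod A f) z) (far F f))) ?S"
      using \<epsilon>'(1)[OF Df Obj_PSh_act_mem[OF P f z]] \<epsilon>_nat[OF f z] by simp
    also have "\<dots> = Comp ?Y (\<epsilon>' (Cod A f) z) (far F f)"
      using \<epsilon>'(1)[OF Cf z] F_src by (simp add: Comp_Arrow_PSh)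
    also have "\<dots> = act (far (?H ?S) f) (\<epsilon>' (Cod A f) z)"
      using H(2)[OF f \<epsilon>'(2)[OF Cf z]] by simp
    finally show "\<epsilon>' (Dom A f) (act (far P f) z) = act (far (?H ?S) f) (\<epsilon>' (Cod A f) z)" .
  qed
  then obtain h where h: "h \<in> hom ?Y c ?S" "\<theta> ?S h = \<epsilon>'"
    using \<theta>_surj[OF S.sub_psh_Obj] by blast
  have ih: "Comp ?Y ?i h \<in> hom ?Y c c"
    using h(1) S.sub_incl_hom by (rule PSh.Comp_hom)
  \<comment> \<open>Naturality of \<theta> at the inclusion sends the arrow \<open>h\<close>, which
    corresponds to \<epsilon>', to one that corresponds to \<epsilon>. The identity of
    \<open>c\<close> also corresponds to \<epsilon>, and \<theta> is injective.\<close>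
  have "\<theta> c (Comp ?Y ?i h) = \<epsilon>"
    using \<theta>_mem[OF c ih] \<epsilon>
  proof (rule Nat_eqI)
    fix x z assume "x \<in> Obj A" "z \<in> carr (fob P x)"
    then show "\<theta> c (Comp ?Y ?i h) x z = \<epsilon> x z"
      using nat[of ?i h x z] homD[OF S.sub_incl_hom] h \<epsilon>'(3) by simp
  qed
  then have "Comp ?Y ?i h = Ident ?Y c"
    using \<theta>_inj[OF c ih id_c] by (simp add: \<epsilon>_def)
  then show ?thesis
    using S.retract_cover[OF h(1)] by (intro exI[of _ "\<lambda>n. act (?t n)"] ballI)
qed


section \<open>Presheaves of bounded size\<close>

text \<open>Elements are renamed along the injections \<open>b x\<close>, and action and norms are
  carried along. As norms are copied exactly, the renaming and its inverse both have norm at least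
  the unit.\<close>

lemma transport_presheaf:
  fixes Q :: "('o, 'a, 'u, 'v) psh" and b :: "'o \<Rightarrow> 'u \<Rightarrow> 'u"
  assumes Q: "Q \<in> Obj (PSh C)" and inj: "\<And>x. x \<in> Obj C \<Longrightarrow> inj_on (b x) (carr (fob Q x))"
  obtains P where "P \<in> Obj (PSh C)" "k_iso (PSh C) Q P"
    "\<And>x. x \<in> Obj C \<Longrightarrow> carr (fob P x) = b x ` carr (fob Q x)"
proof -
  define b' where "b' x = inv_into (carr (fob Q x)) (b x)" for x
  have b'b: "b' x (b x z) = z" if "x \<in> Obj C" "z \<in> carr (fob Q x)" for x z
    using inj that by (simp add: b'_def)
  define S where "S x = NSet (b x ` carr (fob Q x)) (\<lambda>z\<in>b x ` carr (fob Q x). snorm (fob Q x) (b' x z))" for x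
  define P where "P = \<lparr>fob = restrict S (Obj C),
    far = (\<lambda>f\<in>Arr C. Arrow (S (Cod C f))
      (\<lambda>z\<in>carr (S (Cod C f)). b (Dom C f) (act (far Q f) (b' (Cod C f) z))) (S (Dom C f)))\<rparr>"
  have fob: "fob P x = S x" if "x \<in> Obj C" for x
    using that by (simp add: P_def)
  have S: "carr (S x) = b x ` carr (fob Q x)"
    "x \<in> Obj C \<Longrightarrow> z \<in> carr (fob Q x) \<Longrightarrow> snorm (S x) (b x z) = snorm (fob Q x) z" for x z
    by (simp_all add: S_def b'b)
  have far: "src (far P f) = S (Cod C f)" "trg (far P f) = S (Dom C f)"
    "act (far P f) \<in> extensional (carr (S (Cod C f)))"
    "z \<in> carr (fob Q (Cod C f)) \<Longrightarrow> act (far P f) (b (Cod C f) z) = b (Dom C f) (act (far Q f) z)"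
    if "f \<in> Arr C" for f z
    using that by (simp_all add: P_def S(1) b'b Cod_Obj)
  note Q_mem = Obj_PSh_act_mem[OF Q]
  have P: "P \<in> Obj (PSh C)"
  proof (rule Obj_PSh_I)
    show "fob P \<in> extensional (Obj C)" "far P \<in> extensional (Arr C)"
      by (simp_all add: P_def)
    fix x assume x: "x \<in> Obj C"
    show "small TYPE('u) (carr (fob P x))"
      using Obj_PSh_D(1)[OF Q x] by (simp add: x fob S(1) small_image)
    show "snorm (fob P x) \<in> extensional (carr (fob P x))"
      using x by (simp add: fob S_def)
    fix z assume "z \<in> carr (fob P x)"
    then obtain w where "w \<in> carr (fob Q x)" "z = b x w"
      using x by (auto simp: fob S(1))
    then show "act (far P (Ident C x)) z = z"
      using far(4)[of "Ident C x" w] x by (simp add: Ident_Arr Obj_PSh_D(8)[OF Q])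
  next
    fix f assume f: "f \<in> Arr C"
    show "src (far P f) = fob P (Cod C f)" "trg (far P f) = fob P (Dom C f)"
      using f by (simp_all add: far fob Dom_Obj Cod_Obj)
    show "act (far P f) \<in> carr (fob P (Cod C f)) \<rightarrow>\<^sub>E carr (fob P (Dom C f))"
      using f far(3,4)[OF f] Q_mem by (auto simp: fob Dom_Obj Cod_Obj S(1) PiE_def)
    show "Norm C f * snorm (fob P (Cod C f)) z \<le> snorm (fob P (Dom C f)) (act (far P f) z)"
      if "z \<in> carr (fob P (Cod C f))" for z
      using that f far(4)[OF f] Obj_PSh_D(10)[OF Q f] Q_mem by (auto simp: fob Dom_Obj Cod_Obj S)
    fix g z assume g: "g \<in> Arr C" and eq: "Cod C f = Dom C g" and z: "z \<in> carr (fob P (Cod C g))"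
    then obtain w where w: "w \<in> carr (fob Q (Cod C g))" "z = b (Cod C g) w"
      by (auto simp: fob Cod_Obj S(1))
    then show "act (far P (Comp C g f)) z = act (far P f) (act (far P g) z)"
      using far(4)[OF Comp_Arr(1)[OF f g eq], of w] far(4)[OF g, of w] far(4)[OF f, of "act (far Q g) w"]
        Comp_Arr[OF f g eq] Q_mem[OF g] Obj_PSh_D(9)[OF Q f g eq w(1)] by (simp add: eq)
  qed
  let ?u = "Arrow Q (\<lambda>x\<in>Obj C. restrict (b x) (carr (fob Q x))) P"
  let ?w = "Arrow P (\<lambda>x\<in>Obj C. restrict (b' x) (carr (fob P x))) Q"
  have u: "?u \<in> hom (PSh C) Q P"
    using Q P by (rule hom_PSh_I) (auto simp: fob S(1) far)
  have w: "?w \<in> hom (PSh C) P Q"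
    using P Q by (rule hom_PSh_I) (auto simp: fob S(1) far b'b Q_mem Dom_Obj Cod_Obj)
  interpret PSh: normed_category "PSh C :: (('o, 'a, 'u, 'v) psh, _, _) ncat"
    by (rule normed_category_PSh)
  have "1 \<le> Norm (PSh C) ?u" "1 \<le> Norm (PSh C) ?w"
    by (auto simp: le_Norm_PSh_iff[OF u] le_Norm_PSh_iff[OF w] fob S b'b)
  moreover have "Comp (PSh C) ?w ?u = Ident (PSh C) Q"
    using PSh.Comp_hom[OF u w] PSh.Ident_hom[OF Q]
    by (rule hom_PSh_eqI) (simp add: act_Comp_PSh[OF u] act_Ident_PSh fob S(1) b'b)
  moreover have "Comp (PSh C) ?u ?w = Ident (PSh C) P"
    using PSh.Comp_hom[OF w u] PSh.Ident_hom[OF P]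
    by (rule hom_PSh_eqI) (auto simp: act_Comp_PSh[OF w] act_Ident_PSh fob S(1) b'b)
  ultimately have "k_iso (PSh C) Q P"
    using u w unfolding k_iso_iff by blast
  with P show thesis
    using fob S(1) by (intro that[of P]) simp_all
qed

end

text \<open>A presheaf with elements in \<open>K\<close> is given by two functions, one from objects
  to normed sets on subsets of \<open>K\<close> and one from arrows to maps between these. Smallness
  of the quantale bounds the possible norms. An arrow is a triple of source, components and
  target.\<close>

lemma small_presheaves:
  assumes universe: "grothendieck_universe TYPE('u)" and K: "small TYPE('u) (K :: 'u set)"
    and small_quantale: "small TYPE('u) (UNIV :: 'v::comm_quantale set)"
    and small_Obj: "small TYPE('u) (Obj C)" and small_Arr: "small TYPE('u) (Arr C)"
    and R: "R \<subseteq> Obj (PSh C :: (('o, 'a, 'u, 'v) psh, _, _) ncat)"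
    and R_K: "\<And>P x. P \<in> R \<Longrightarrow> x \<in> Obj C \<Longrightarrow> carr (fob P x) \<subseteq> K"
    and C: "normed_category C"
  shows "small TYPE('u) R" and "small TYPE('u) (Arr (full_sub (PSh C) R))"
proof -
  interpret normed_category C by (rule C)
  note small_Times = small_Times[OF universe] and small_PiE = small_PiE[OF universe]
  \<comment> \<open>Extensional maps between subsets of \<open>K\<close>. Their domains are dropped,
    since the surrounding \<open>Arrow\<close> records source and target.\<close>
  define FS :: "('u \<Rightarrow> 'u) set" where "FS = snd ` {(D, f). D \<subseteq> K \<and> f \<in> D \<rightarrow>\<^sub>E K}"
  have FS: "f \<in> D \<rightarrow>\<^sub>E E \<Longrightarrow> D \<subseteq> K \<Longrightarrow> E \<subseteq> K \<Longrightarrow> f \<in> FS" for f D E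
    unfolding FS_def by (rule rev_image_eqI[of "(D, f)"]) (auto simp: PiE_def)
  define NS :: "('u, 'v) nset set" where
    "NS = (\<lambda>(D, f). NSet D f) ` {(D, f). D \<subseteq> K \<and> f \<in> D \<rightarrow>\<^sub>E (UNIV :: 'v set)}"
  have NS: "A \<in> NS" if "carr A \<subseteq> K" "snorm A \<in> extensional (carr A)" for A
    unfolding NS_def using that by (intro rev_image_eqI[of "(carr A, snorm A)"]) (auto simp: PiE_def)
  define MS :: "('u, 'v) nmap set" where "MS = (\<lambda>(A, f, B). Arrow A f B) ` (NS \<times> FS \<times> NS)"
  have "small TYPE('u) FS" "small TYPE('u) NS"
    unfolding FS_def NS_def
    using small_partial_functions[OF universe K K] small_partial_functions[OF universe K small_quantale]
    by (simp_all add: small_image)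
  moreover from this have "small TYPE('u) MS"
    unfolding MS_def by (intro small_image small_Times)
  ultimately have FNM: "small TYPE('u) FS" "small TYPE('u) (Obj C \<rightarrow>\<^sub>E NS)" "small TYPE('u) (Arr C \<rightarrow>\<^sub>E MS)"
    using small_Obj small_Arr by (simp_all add: small_PiE)
  show small_R: "small TYPE('u) R"
  proof (rule small_image_subset[OF small_Times[OF FNM(2,3)]], rule subsetI)
    fix P assume P: "P \<in> R"
    then have P': "P \<in> Obj (PSh C)" using R by blast
    have fob: "fob P x \<in> NS" if "x \<in> Obj C" for x
      using that R_K[OF P] Obj_PSh_D(2)[OF P'] by (intro NS)
    have "far P f \<in> MS" if f: "f \<in> Arr C" for f
      unfolding MS_def
    proof (rule rev_image_eqI)
      show "(fob P (Cod C f), act (far P f), fob P (Dom C f)) \<in> NS \<times> FS \<times> NS"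
        using fob Dom_Obj[OF f] Cod_Obj[OF f] FS[OF Obj_PSh_D(5)[OF P' f]] R_K[OF P] by simp
      show "far P f = (\<lambda>(A, f, B). Arrow A f B) (fob P (Cod C f), act (far P f), fob P (Dom C f))"
        using Obj_PSh_D(3,4)[OF P' f] by (cases "far P f") simp
    qed
    then show "P \<in> (\<lambda>(p, q). \<lparr>fob = p, far = q\<rparr>) ` ((Obj C \<rightarrow>\<^sub>E NS) \<times> (Arr C \<rightarrow>\<^sub>E MS))"
      using fob Obj_PSh_D(6,7)[OF P']
      by (intro rev_image_eqI[of "(fob P, far P)"]) (auto simp: PiE_def)
  qed
  have "small TYPE('u) (R \<times> (Obj C \<rightarrow>\<^sub>E FS) \<times> R)"
    using FNM(1) small_R small_Obj by (intro small_Times small_PiE)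
  then show "small TYPE('u) (Arr (full_sub (PSh C) R))"
  proof (rule small_image_subset, intro subsetI)
    fix t assume "t \<in> Arr (full_sub (PSh C) R)"
    then have st: "src t \<in> R" "trg t \<in> R" and t: "act t \<in> carr (Nat C (src t) (trg t))"
      by (simp_all add: PSh_simps(2-4))
    have "act t x \<in> FS" if x: "x \<in> Obj C" for x
    proof (rule FS)
      show "act t x \<in> carr (fob (src t) x) \<rightarrow>\<^sub>E carr (fob (trg t) x)"
        using t x by (auto simp: mem_Nat_iff)
    qed (use st x R_K in blast)+
    then have "act t \<in> Obj C \<rightarrow>\<^sub>E FS"
      using t by (auto simp: mem_Nat_iff PiE_def)
    with st show "t \<in> (\<lambda>(P, f, Q). Arrow P f Q) ` (R \<times> (Obj C \<rightarrow>\<^sub>E FS) \<times> R)"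
      by (intro rev_image_eqI[of "(src t, act t, trg t)"]) simp_all
  qed
qed

section \<open>Closure properties of the presheaves bounded by a cardinal\<close>

context
  includes cardinal_syntax
begin

text \<open>An infinite cardinal absorbs countable unions of sets that it bounds, and passing to
  images does not increase cardinality.\<close>

lemma card_of_countable_cover:
  assumes K: "infinite K" and cover: "A \<subseteq> (\<Union>n::nat. t n ` B n)" and B: "\<And>n. |B n| \<le>o |K|"
  shows "|A| \<le>o |K|"
proof -
  have "|\<Union>n. t n ` B n| \<le>o |K|"
  proof (rule card_of_UNION_ordLeq_infinite[OF K])
    show "|UNIV :: nat set| \<le>o |K|"
      using K by (simp add: infinite_iff_card_of_nat)
    show "\<forall>n\<in>UNIV. |t n ` B n| \<le>o |K|"
      using B card_of_image ordLeq_transitive by blast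
  qed
  with card_of_mono1[OF cover] show ?thesis
    by (rule ordLeq_transitive)
qed

text \<open>The bound is on cardinalities and not an inclusion into \<open>K\<close>, because the
  class has to be invariant under isomorphism. Inclusion into \<open>K\<close> is restored later by
  renaming elements.\<close>

definition bounded_presheaves ::
    "('u, 'u, 'v::comm_quantale) ncat \<Rightarrow> 'u set \<Rightarrow> ('u, 'u, 'u, 'v) psh set" where
  "bounded_presheaves X K = {P \<in> Obj (PSh X). \<forall>x\<in>Obj X. |carr (fob P x)| \<le>o |K|}"

text \<open>An isomorphism is onto at each object, its inverse supplying the preimages.\<close>

lemma replete_bounded: "replete (PSh X) (bounded_presheaves X K)"
  unfolding replete_def
proof (intro ballI impI)
  fix P Q assume P: "P \<in> bounded_presheaves X K" and Q: "Q \<in> Obj (PSh X)" and "k_iso (PSh X) P Q"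
  then obtain f g where f: "f \<in> hom (PSh X) P Q" and g: "g \<in> hom (PSh X) Q P"
    and fg: "Comp (PSh X) f g = Ident (PSh X) Q"
    unfolding k_iso_iff by blast
  have "|carr (fob Q x)| \<le>o |K|" if x: "x \<in> Obj X" for x
  proof -
    have "z \<in> act f x ` carr (fob P x)" if z: "z \<in> carr (fob Q x)" for z
    proof (rule rev_image_eqI)
      show "act g x z \<in> carr (fob P x)"
        using g x z by (rule hom_PSh_mem)
      show "z = act f x (act g x z)"
        using act_Comp_PSh[OF g x z, of f] x z by (simp add: fg act_Ident_PSh)
    qed
    then have "|carr (fob Q x)| \<le>o |carr (fob P x)|"
      by (meson card_of_image card_of_mono1 ordLeq_transitive subsetI)
    moreover have "|carr (fob P x)| \<le>o |K|"
      using P x by (simp add: bounded_presheaves_def)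
    ultimately show ?thesis
      by (rule ordLeq_transitive)
  qed
  with Q show "Q \<in> bounded_presheaves X K"
    by (simp add: bounded_presheaves_def)
qed

text \<open>Countably many values \<open>F (a n)\<close> cover the colimit, however large the index
  category and the weight are. Hence one infinite \<open>K\<close> serves for all \<Phi>-colimits at
  once.\<close>

lemma Phi_closed_bounded:
  fixes X :: "('u, 'u, 'v::comm_quantale) ncat"
  assumes X: "normed_category X" and K: "infinite K"
  shows "Phi_closed X (bounded_presheaves X K)"
  unfolding Phi_closed_def
proof (intro allI impI)
  fix A :: "('u, 'u, 'v) ncat" and F P c
  assume "small_ncat A" and F: "normed_functor A (PSh X) F"
    and bounded: "\<forall>a\<in>Obj A. fob F a \<in> bounded_presheaves X K"
    and P: "P \<in> Phi_weights A" and colim: "weighted_colimit A (PSh X) F P c"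
  then have A: "normed_category A" by (simp add: small_ncat_def)
  show "c \<in> bounded_presheaves X K"
  proof (rule Phi_weights_generated[OF A P])
    fix a :: "nat \<Rightarrow> 'u" and w
    assume P_Obj: "P \<in> Obj (PSh A)" and a: "\<And>n. a n \<in> Obj A" and w: "\<And>n. w n \<in> carr (fob P (a n))"
      and gen: "\<And>x z. x \<in> Obj A \<Longrightarrow> z \<in> carr (fob P x) \<Longrightarrow> \<exists>n. \<exists>f\<in>hom A x (a n). z = act (far P f) (w n)"
    obtain t where t: "\<forall>x\<in>Obj X. carr (fob c x) \<subseteq> (\<Union>n. t n x ` carr (fob (fob F (a n)) x))"
      using normed_category.weighted_colimit_cover[OF X A F P_Obj colim a w gen] ..
    have "|carr (fob c x)| \<le>o |K|" if x: "x \<in> Obj X" for x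
      using K bspec[OF t x]
      by (rule card_of_countable_cover) (use bounded a x in \<open>simp add: bounded_presheaves_def\<close>)
    then show ?thesis
      using colim by (simp add: bounded_presheaves_def weighted_colimit_def)
  qed
qed

text \<open>By minimality of \<Phi>(X) it is enough that the bounded presheaves have the defining
  closure properties. Representables are bounded because their elements are arrows of
  \<open>X\<close>.\<close>

lemma Phi_obj_bounded:
  fixes X :: "('u, 'u, 'v::comm_quantale) ncat"
  assumes X: "small_ncat X" and K: "infinite K" "Arr X \<subseteq> K"
  shows "Phi_obj X \<subseteq> bounded_presheaves X K"
proof -
  interpret normed_category X using X by (simp add: small_ncat_def)
  have small_hom: "small TYPE('u) (hom X x a)" for x a
    using X small_subset[of "Arr X" "hom X x a"] by (auto simp: small_ncat_def hom_def)
  have "representable X a \<in> bounded_presheaves X K" for a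
  proof -
    have "|carr (fob (representable X a) x)| \<le>o |K|" if "x \<in> Obj X" for x
      using that K(2) by (intro card_of_mono1) (auto simp: fob_representable homset_def hom_def)
    then show ?thesis
      using representable_in_PSh[OF small_hom] by (simp add: bounded_presheaves_def)
  qed
  moreover have "bounded_presheaves X K \<subseteq> Obj (PSh X)"
    by (auto simp: bounded_presheaves_def)
  ultimately show ?thesis
    using replete_bounded Phi_closed_bounded[OF normed_category_axioms K(1)]
    unfolding Phi_obj_def by blast
qed

end

section \<open>Essential smallness of the cocompletion\<close>

lemma replete_Phi_obj: "replete (PSh X) (Phi_obj X)"
  unfolding Phi_obj_def replete_def by blast

theorem lemma11p1:
  fixes X :: "('u, 'u, 'v::comm_quantale) ncat"
  assumes universe: "grothendieck_universe TYPE('u)"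
    and small_quantale: "small TYPE('u) (UNIV :: 'v set)"
    and A_or_B: "(1 :: 'v) = Sup {e. totally_below e 1} \<or>
                 (\<forall>W :: 'v set. inf 1 (Sup W) = (SUP w\<in>W. inf 1 w))"
    and X: "small_ncat X"
  shows "essentially_small TYPE('u) (Phi_cat X)"
proof -
  interpret normed_category X using X by (simp add: small_ncat_def)
  have small_X: "small TYPE('u) (Obj X)" "small TYPE('u) (Arr X)"
    using X by (simp_all add: small_ncat_def)
  obtain N :: "'u set" where N: "infinite N" "small TYPE('u) N"
    using universe by (auto simp: grothendieck_universe_def)
  \<comment> \<open>The arrows of \<open>X\<close> bound the representables; \<open>N\<close> makes
    \<open>K\<close> infinite even if \<open>X\<close> has only finitely many arrows.\<close>
  define K where "K = Arr X \<union> N"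
  have K: "infinite K" "Arr X \<subseteq> K" "small TYPE('u) K"
    using N small_X small_Un[OF universe] by (auto simp: K_def)
  have bounded: "Phi_obj X \<subseteq> bounded_presheaves X K"
    using X K(1,2) by (rule Phi_obj_bounded)
  then have Phi_PSh: "Phi_obj X \<subseteq> Obj (PSh X)"
    by (auto simp: bounded_presheaves_def)
  \<comment> \<open>The representatives: members of \<Phi>(X) whose elements already lie in
    \<open>K\<close>.\<close>
  define R where "R = {P \<in> Phi_obj X. \<forall>x\<in>Obj X. carr (fob P x) \<subseteq> K}"
  have R: "R \<subseteq> Phi_obj X"
    by (auto simp: R_def)
  interpret PSh: normed_category "PSh X :: (('u, 'u, 'u, 'v) psh, _, _) ncat"
    by (rule normed_category_PSh)
  interpret Phi: normed_category "Phi_cat X"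
    unfolding Phi_cat_def using Phi_PSh by (rule PSh.normed_category_full_sub)
  have skeleton: "\<exists>P\<in>R. k_iso (PSh X) Q P" if Q: "Q \<in> Phi_obj X" for Q
  proof -
    have "\<forall>x\<in>Obj X. \<exists>b. inj_on b (carr (fob Q x)) \<and> b ` carr (fob Q x) \<subseteq> K"
      using Q bounded by (auto simp: bounded_presheaves_def card_of_ordLeq)
    from bchoice[OF this] obtain b where b: "\<And>x. x \<in> Obj X \<Longrightarrow> inj_on (b x) (carr (fob Q x))"
      "\<And>x. x \<in> Obj X \<Longrightarrow> b x ` carr (fob Q x) \<subseteq> K"
      by blast
    obtain P where P: "P \<in> Obj (PSh X)" "k_iso (PSh X) Q P"
      "\<And>x. x \<in> Obj X \<Longrightarrow> carr (fob P x) = b x ` carr (fob Q x)"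
      using Q Phi_PSh b(1) by (blast intro: transport_presheaf)
    \<comment> \<open>Repleteness keeps the renamed copy inside \<Phi>(X).\<close>
    then have "P \<in> Phi_obj X"
      using Q replete_Phi_obj[of X] unfolding replete_def by blast
    then have "P \<in> R"
      using b(2) P(3) by (simp add: R_def)
    with P(2) show ?thesis by blast
  qed
  show ?thesis
  proof (rule Phi.essentially_smallI)
    show "R \<subseteq> Obj (Phi_cat X)"
      using R by (simp add: Phi_cat_def)
    show "\<exists>P\<in>R. k_iso (Phi_cat X) Q P" if "Q \<in> Obj (Phi_cat X)" for Q
      using that skeleton[of Q] R by (auto simp: Phi_cat_def k_iso_full_sub subset_iff)
    have "R \<subseteq> Obj (PSh X)" using R Phi_PSh by blast
    note small_presheaves[OF universe K(3) small_quantale small_X this _ normed_category_axioms]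
    then have "small TYPE('u) R" "small TYPE('u) (Arr (full_sub (PSh X) R))"
      by (simp_all add: R_def)
    moreover have "Arr (full_sub (Phi_cat X) R) \<subseteq> Arr (full_sub (PSh X) R)"
      by (auto simp: Phi_cat_def)
    ultimately show "small TYPE('u) R" "small TYPE('u) (Arr (full_sub (Phi_cat X) R))"
      by (simp_all add: small_subset)
  qed
qed

end
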